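(* Let $(\Gamma(\omega))_{\omega\in\Omega}$ be a family of random graphs as described in the context, and suppose that there exist $R^*\ge 1$, constants $c_1,q_0>0$ and a function $p(\lambda)\ge 0$ with $p(\lambda)\le c_1\lambda^{-q_0}$ for all $\lambda>1$, such that $\mathbb{P}(R\in J(\lambda))\ge 1-p(\lambda)$ for each $R\ge R^*$ and each $\lambda>1$. (a) There exists a subset $\Omega_0\subset\Omega$ with $\mathbb{P}(\Omega_0)=1$ such that for each $\omega\in\Omega_0$ and $x\in G(\omega)$, $$\lim_{n\to\infty}\frac{\log S_n}{\log n}=\frac23,\quad P^x_\omega\text{-a.s.}$$ (b) Suppose in addition that there exists a constant $c_0$ such that all vertices in $G$ have degree less than $c_0$. Then (for each $\omega\in\Omega_0$ and $x\in G(\omega)$) $$\lim_{n\to\infty}\frac{\log|W_n|}{\log n}=\frac23,\quad P^x_\omega\text{-a.s.}$$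
   Context: Random graphs. $(\Omega,\mathcal{F},\mathbb{P})$ is a probability space carrying a family of random graphs $\Gamma(\omega)=(G(\omega),E(\omega))$, $\omega\in\Omega$, with unoriented edges; for each $\omega$ the graph $\Gamma(\omega)$ is infinite, locally finite and connected, and contains a marked vertex $0\in G(\omega)$. Write $x\sim y$ if $\{x,y\}\in E$; $\mu_x$ is the number of edges containing $x$, and $\mu$ is extended to a measure on $G$. $d(x,y)$ is the graph distance, $B(R)=\{y:d(0,y)<R\}$, $V(R)=\mu(B(R))$. Random walk. $X=(X_n)_{n\ge0}$ under $P^x_\omega$ is simple random walk on $\Gamma(\omega)$ started at $x$ (transition probability $1/\mu_x$ to each neighbour). $W_n=\{X_0,X_1,\dots,X_n\}$ is the set of vertices visited up to time $n$, $|W_n|$ its cardinality, and $S_n=\mu(W_n)=\sum_{x\in W_n}\mu_x$. Effective resistance. Let $\mathcal{E}(f,f)=\frac12\sum_{x,y\in G,\,x\sim y}(f(x)-f(y))^2$. For disjoint $A,B\subset G$, $R_{\rm eff}(A,B)^{-1}=\inf\{\mathcal{E}(f,f): f\in\mathbb{R}^G,\ \mathcal{E}(f,f)<\infty,\ f|_A=1,\ f|_B=0\}$. Good scales. For $\lambda>1$, $J(\lambda)$ is the (random) set of $R\in[1,\infty)$ such that all of the following hold: (1) $V(R)\le\lambda R^2$; (2) $V(R)\ge\lambda^{-1}R^2$; (3) $R_{\rm eff}(0,B(R)^c)\ge\lambda^{-1}R$. *)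

theory Defs
  imports "HOL-Probability.Probability"
begin

definition simple_graph :: "'v set \<Rightarrow> 'v set set \<Rightarrow> bool" where
  "simple_graph G E \<longleftrightarrow> (\<forall>e\<in>E. e \<subseteq> G \<and> card e = 2)"

definition adj :: "'v set set \<Rightarrow> 'v \<Rightarrow> 'v \<Rightarrow> bool" where
  "adj E x y \<longleftrightarrow> {x, y} \<in> E"

definition vdeg :: "'v set set \<Rightarrow> 'v \<Rightarrow> nat" where
  "vdeg E x = card {e \<in> E. x \<in> e}"

definition locally_finite_graph :: "'v set \<Rightarrow> 'v set set \<Rightarrow> bool" where
  "locally_finite_graph G E \<longleftrightarrow> (\<forall>x\<in>G. finite {e \<in> E. x \<in> e})"

definition connected_graph :: "'v set \<Rightarrow> 'v set set \<Rightarrow> bool" where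
  "connected_graph G E \<longleftrightarrow> (\<forall>x\<in>G. \<forall>y\<in>G. (adj E)\<^sup>*\<^sup>* x y)"

text \<open>The distance is junk when no path joins \<open>x\<close> and \<open>y\<close>; it is used for connected graphs only.\<close>

definition graph_dist :: "'v set set \<Rightarrow> 'v \<Rightarrow> 'v \<Rightarrow> nat" where
  "graph_dist E x y = (LEAST n. (adj E ^^ n) x y)"

definition graph_ball :: "'v set \<Rightarrow> 'v set set \<Rightarrow> 'v \<Rightarrow> real \<Rightarrow> 'v set" where
  "graph_ball G E x R = {y \<in> G. real (graph_dist E x y) < R}"

text \<open>The extension of the vertex degrees to a measure on the vertices, for finite sets of vertices.\<close>

definition vol :: "'v set set \<Rightarrow> 'v set \<Rightarrow> real" where
  "vol E A = (\<Sum>x\<in>A. real (vdeg E x))"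

text \<open>The sum is over ordered pairs, so that each edge is counted twice.\<close>

definition energy :: "'v set set \<Rightarrow> ('v \<Rightarrow> real) \<Rightarrow> ennreal" where
  "energy E f = (\<Sum>\<^sub>\<infinity>(x, y)\<in>{(x, y). adj E x y}. ennreal ((f x - f y)\<^sup>2)) / 2"

text \<open>Values in \<open>[0, \<infinity>]\<close>, where \<open>inverse 0 = \<infinity>\<close>, \<open>inverse \<infinity> = 0\<close> and \<open>Inf {} = \<infinity>\<close>.\<close>

definition eff_resistance :: "'v set set \<Rightarrow> 'v set \<Rightarrow> 'v set \<Rightarrow> ennreal" where
  "eff_resistance E A B =
     inverse (Inf {energy E f |f. energy E f < \<infinity> \<and> (\<forall>a\<in>A. f a = 1) \<and> (\<forall>b\<in>B. f b = 0)})"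

definition good_scales :: "'v set \<Rightarrow> 'v set set \<Rightarrow> 'v \<Rightarrow> real \<Rightarrow> real set" where
  "good_scales G E v l =
     {R. 1 \<le> R
       \<and> vol E (graph_ball G E v R) \<le> l * R\<^sup>2
       \<and> vol E (graph_ball G E v R) \<ge> R\<^sup>2 / l
       \<and> eff_resistance E {v} (G - graph_ball G E v R) \<ge> ennreal (R / l)}"

text \<open>
  The conditional law of the \<open>n\<close>-th position given the positions \<open>X 0, \<dots>, X (n - 1)\<close>.
  The distribution \<^const>\<open>pmf_of_set\<close> is meaningful for finite non-empty sets only; in an infinite,
  connected, locally finite graph all sets of neighbours of vertices are of this kind.
\<close>

definition srw_step :: "'v set set \<Rightarrow> 'v \<Rightarrow> nat \<Rightarrow> (nat \<Rightarrow> 'v) \<Rightarrow> 'v measure" where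
  "srw_step E x n X =
     measure_pmf (case n of 0 \<Rightarrow> return_pmf x | Suc m \<Rightarrow> pmf_of_set {y. adj E (X m) y})"

lemma Ionescu_Tulcea_srw:
  fixes E :: "'v set set"
  shows "Ionescu_Tulcea (srw_step E x) (\<lambda>_. count_space UNIV)"
proof (rule Ionescu_Tulcea.intro)
  fix i :: nat
  show "srw_step E x i \<in> measurable (PiM {0..<i} (\<lambda>_. count_space UNIV)) (subprob_algebra (count_space UNIV))"
  proof (cases i)
    case 0
    have "measure_pmf (return_pmf x) \<in> space (subprob_algebra (count_space UNIV))"
      by (simp add: space_subprob_algebra measure_pmf.subprob_space_axioms)
    then show ?thesis
      using 0 by (simp add: srw_step_def[abs_def])
  next
    case (Suc m)
    have "(\<lambda>X. X m) \<in> measurable (PiM {0..<i} (\<lambda>_. count_space UNIV)) (count_space UNIV)"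
      using Suc by (intro measurable_component_singleton) auto
    moreover have "(\<lambda>v. measure_pmf (pmf_of_set {y. adj E v y}))
        \<in> measurable (count_space UNIV) (subprob_algebra (count_space UNIV))"
      by (auto simp: space_subprob_algebra measure_pmf.subprob_space_axioms)
    ultimately show ?thesis
      using Suc by (simp add: srw_step_def[abs_def] measurable_compose)
  qed
next
  fix i :: nat and X :: "nat \<Rightarrow> 'v"
  show "prob_space (srw_step E x i X)"
    by (simp add: srw_step_def measure_pmf.prob_space_axioms)
qed

text \<open>The law of the walk started at \<open>x\<close>, on the space of vertex sequences.\<close>

definition srw :: "'v set set \<Rightarrow> 'v \<Rightarrow> (nat \<Rightarrow> 'v) measure" where
  "srw E x = projective_family.lim UNIV
     (Ionescu_Tulcea.CI (srw_step E x) (\<lambda>_. count_space UNIV)) (\<lambda>_. count_space UNIV)"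

lemma sets_srw: "sets (srw E x) = sets (PiM UNIV (\<lambda>_. count_space UNIV))"
proof -
  interpret Ionescu_Tulcea "srw_step E x" "\<lambda>_. count_space UNIV"
    by (rule Ionescu_Tulcea_srw)
  show ?thesis
    by (simp add: srw_def)
qed

lemma space_srw: "space (srw E x) = UNIV"
  using sets_eq_imp_space_eq[OF sets_srw, of E x] by (simp add: space_PiM)

lemma prob_space_srw: "prob_space (srw E x)"
proof -
  interpret Ionescu_Tulcea "srw_step E x" "\<lambda>_. count_space UNIV"
    by (rule Ionescu_Tulcea_srw)
  have "emeasure PF.lim (PF.emb UNIV {} (space (PiM {} (\<lambda>_. count_space UNIV)))) = emeasure (CI {}) (space (PiM {} (\<lambda>_. count_space UNIV)))"
    by (intro lim) auto
  also have "\<dots> = 1"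
    using prob_space.emeasure_space_1[OF PF.prob_space_P[of "{}"]] by (simp add: PF.space_P)
  finally show ?thesis
    by (intro prob_spaceI) (simp add: srw_def space_PiM prod_emb_def restrict_def vimage_def)
qed

lemma emeasure_srw_cylinder:
  "emeasure (srw E x) {X. \<forall>i<n. X i = y i} = (\<Prod>i<n. emeasure (srw_step E x i y) {y i})"
proof -
  let ?M = "\<lambda>_::nat. count_space (UNIV :: 'a set)"
  interpret Ionescu_Tulcea "srw_step E x" ?M
    by (rule Ionescu_Tulcea_srw)
  have sp: "space (PiM {0..<k} ?M) = extensional {0..<k}" for k
    by (auto simp: space_PiM PiE_def)
  have cyl_eq: "PiE {0..<k} (\<lambda>i. {y i}) = {restrict y {0..<k}}" for k
    proof (intro set_eqI iffI)
    fix f assume "f \<in> PiE {0..<k} (\<lambda>i. {y i})"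
    then have "f i = restrict y {0..<k} i" for i
      using PiE_mem[of f "{0..<k}" "\<lambda>i. {y i}" i] PiE_arb[of f "{0..<k}" "\<lambda>i. {y i}" i]
      by (cases "i \<in> {0..<k}") simp_all
    then show "f \<in> {restrict y {0..<k}}" by (simp add: fun_eq_iff)
  qed (simp add: restrict_PiE_iff)
  have cyl: "{restrict y {0..<k}} \<in> sets (PiM {0..<k} ?M)" for k
    unfolding cyl_eq[symmetric] by (intro sets_PiM_I_finite) auto
  have undef: "(\<lambda>_. undefined) \<in> space (PiM {0..<0} ?M)"
    by (simp add: sp)
  have C: "emeasure (C 0 n (\<lambda>_. undefined)) {restrict y {0..<n}}
      = (\<Prod>i<n. emeasure (srw_step E x i y) {y i})" for n
  proof (induction n)
    case 0
    have "{restrict y {}} \<in> sets (PiM {} ?M)" using cyl[of 0] by simp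
    then show ?case
      by (simp add: restrict_def emeasure_return)
  next
    case (Suc n)
    let ?z = "restrict y {0..<n}"
    have step_eq: "srw_step E x n ?z = srw_step E x n y"
      by (cases n) (simp_all add: srw_step_def)
    have eP: "emeasure (eP n X) {restrict y {0..<Suc n}}
        = emeasure (srw_step E x n y) {y n} * indicator {?z} X"
      if X: "X \<in> space (PiM {0..<n} ?M)" for X
    proof -
      have X_ext: "X \<in> extensional {0..<n}" using X by (simp add: sp)
      have "emeasure (eP n X) {restrict y {0..<Suc n}}
          = emeasure (srw_step E x n X) ((\<lambda>v. X(n := v)) -` {restrict y {0..<Suc n}})"
        using emeasure_eP[OF X cyl] by simp
      also have "(\<lambda>v. X(n := v)) -` {restrict y {0..<Suc n}} = (if X = ?z then {y n} else {})"
      proof -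
        have "X(n := v) = restrict y {0..<Suc n} \<longleftrightarrow> X = ?z \<and> v = y n" for v
        proof
          assume *: "X(n := v) = restrict y {0..<Suc n}"
          have "v = y n" using fun_cong[OF *, of n] by simp
          moreover have "X i = ?z i" for i
          proof (cases "i < n")
            case True
            then show ?thesis using fun_cong[OF *, of i] by simp
          next
            case False
            then show ?thesis using extensional_arb[OF X_ext, of i] by simp
          qed
          ultimately show "X = ?z \<and> v = y n" by auto
        next
          assume "X = ?z \<and> v = y n"
          then show "X(n := v) = restrict y {0..<Suc n}" by (intro ext) auto
        qed
        moreover have "{v. Q \<and> v = a} = (if Q then {a} else {})" for Q and a :: 'a
          by auto
        ultimately show ?thesis
          by (simp only: vimage_def singleton_iff)
      qed
      finally show ?thesis
        by (cases "X = ?z") (simp_all only: step_eq if_True if_False indicator_simps singleton_iff emeasure_empty mult_1_right mult_zero_right simp_thms)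
    qed
    have "emeasure (C 0 (Suc n) (\<lambda>_. undefined)) {restrict y {0..<Suc n}}
        = (\<integral>\<^sup>+X. emeasure (eP n X) {restrict y {0..<Suc n}} \<partial>C 0 n (\<lambda>_. undefined))"
    proof -
      have "eP n \<in> measurable (C 0 n (\<lambda>_. undefined)) (subprob_algebra (PiM {0..<Suc n} ?M))"
        using measurable_eP[of n] by (simp only: measurable_cong_sets[OF sets_C[OF undef] refl] add_0)
      moreover have "space (C 0 n (\<lambda>_. undefined)) \<noteq> {}"
        using prob_space.not_empty[OF prob_space_C[OF undef]] by simp
      ultimately show ?thesis
        by (simp add: emeasure_bind[OF _ _ cyl])
    qed
    also have "\<dots> = (\<integral>\<^sup>+X. emeasure (srw_step E x n y) {y n} * indicator {?z} X \<partial>C 0 n (\<lambda>_. undefined))"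
      by (intro nn_integral_cong eP) (simp add: space_C[OF undef])
    also have "\<dots> = emeasure (srw_step E x n y) {y n} * emeasure (C 0 n (\<lambda>_. undefined)) {?z}"
      using cyl[of n] by (intro nn_integral_cmult_indicator) (simp add: sets_C[OF undef])
    finally show ?case
      by (simp only: Suc.IH prod.lessThan_Suc mult.commute)
  qed
  have "{X. \<forall>i<n. X i = y i} = PF.emb UNIV {0..<n} {restrict y {0..<n}}"
  proof -
    have "(\<forall>i<n. X i = y i) \<longleftrightarrow> restrict X {0..<n} = restrict y {0..<n}" for X
      by (metis (no_types, lifting) atLeastLessThan_iff le0 restrict_apply' restrict_ext)
    then show ?thesis by (simp add: prod_emb_def space_PiM vimage_def)
  qed
  then have "emeasure (srw E x) {X. \<forall>i<n. X i = y i} = emeasure (CI {0..<n}) {restrict y {0..<n}}"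
    using lim[OF _ cyl[of n]] by (simp add: srw_def)
  also have "\<dots> = emeasure (C 0 n (\<lambda>_. undefined)) {restrict y {0..<n}}"
    using emeasure_CI[OF order_refl cyl[of n]] by (simp add: prod_emb_id sp cyl_eq[symmetric])
  finally show ?thesis using C by simp
qed

end

theory Submission
  imports Defs
begin

text \<open>
  By Borel--Cantelli, almost surely for every \<open>m\<close> and all large \<open>k\<close> the scale \<open>2 ^ (m * k)\<close> is good with
  constant \<open>q = 2 ^ k\<close>; the rest concerns one such graph. Fix a large \<open>N\<close> and put \<open>n = q ^ (3 * N)\<close>,
  \<open>r = q ^ N\<close>, \<open>R = q ^ (N + 4)\<close>. Let \<open>h\<close> be the Green function up to time \<open>n\<close> of the walk from \<open>x\<close> killed
  outside the ball \<open>B(R)\<close>, as a density with respect to the degrees. Summation by parts shows that its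
  energy is at most \<open>h x\<close>. Its total mass is at most \<open>n\<close>, so \<open>h \<le> n / V(r)\<close> somewhere in \<open>B(r)\<close>, and since the
  energy controls differences along geodesics, \<open>h x\<close> is at most about \<open>n / V(r) + r\<close>.

  Upper bound: a potential \<open>f\<close> with \<open>f = 1\<close> at the root, \<open>f = 0\<close> outside \<open>B(R)\<close> and energy of order \<open>q / R\<close> exists by
  the resistance hypothesis. Testing it against \<open>h\<close> bounds the probability of leaving \<open>B(R)\<close> before time \<open>n\<close>
  by about the square root of \<open>h x * q / R\<close>, which is of order \<open>1 / q\<close>. Hence \<open>S n \<le> V(R)\<close>.

  Lower bound: by the Cauchy--Schwarz inequality \<open>n\<^sup>2\<close> is at most \<open>S n\<close> times the number of pairs of times at
  which the walk is at the same vertex, weighted by the inverse degree. The Green function on the diagonal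
  bounds the expectation of that number inside \<open>B(R)\<close> by a multiple of \<open>n * R\<close>.

  Both failure probabilities are summable in \<open>k\<close>, and \<open>S\<close> is monotone, so letting \<open>N\<close> grow yields the
  exponent \<open>2/3\<close>.
\<close>

section \<open>Locally finite rooted graphs\<close>

locale rooted_graph =
  fixes G :: "'v set" and E :: "'v set set" and v :: 'v
  assumes simple: "simple_graph G E"
    and infinite: "infinite G"
    and loc_fin: "locally_finite_graph G E"
    and conn: "connected_graph G E"
    and root: "v \<in> G"
begin

lemma adj_sym: "adj E x y \<Longrightarrow> adj E y x"
  by (simp add: adj_def insert_commute)

lemma adj_commute: "adj E x y \<longleftrightarrow> adj E y x"
  by (rule iffI) (erule adj_sym)+

lemma adjD:
  assumes "adj E x y"
  shows "x \<in> G" "y \<in> G" "x \<noteq> y"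
proof -
  have "{x, y} \<subseteq> G" "card {x, y} = 2"
    using assms simple by (auto simp: adj_def simple_graph_def)
  then show "x \<in> G" "y \<in> G" "x \<noteq> y" by auto
qed

text \<open>The degree counts edges while the walk chooses a neighbour. Every edge has exactly two
  ends, so the end other than \<open>x\<close> identifies the edge.\<close>

lemma bij_nbrs:
  "bij_betw (\<lambda>y. {x, y}) {y. adj E x y} {e \<in> E. x \<in> e}"
proof (rule bij_betwI')
  fix y z assume "y \<in> {y. adj E x y}" "z \<in> {y. adj E x y}"
  then show "({x, y} = {x, z}) = (y = z)" by (auto simp: doubleton_eq_iff)
next
  fix e assume e: "e \<in> {e \<in> E. x \<in> e}"
  then have "card e = 2" using simple by (auto simp: simple_graph_def)
  then obtain a b where "e = {a, b}" by (auto simp: card_2_iff)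
  then obtain c where "e = {x, c}" using e by (auto simp: doubleton_eq_iff)
  with e show "\<exists>y\<in>{y. adj E x y}. e = {x, y}"
    by (auto simp: adj_def)
qed (auto simp: adj_def)

lemma card_nbrs: "card {y. adj E x y} = vdeg E x"
  using bij_betw_same_card[OF bij_nbrs] by (simp add: vdeg_def)

lemma finite_nbrs: "finite {y. adj E x y}"
proof (cases "x \<in> G")
  case True
  then show ?thesis
    using bij_betw_finite[OF bij_nbrs, of x] loc_fin by (simp add: locally_finite_graph_def)
next
  case False
  then have "{y. adj E x y} = {}" using adjD(1)[of x] by auto
  then show ?thesis by simp
qed

lemma nbrs_nonempty:
  assumes "x \<in> G"
  shows "{y. adj E x y} \<noteq> {}"
proof -
  have "infinite (G - {x})" using infinite by simp
  then have "G - {x} \<noteq> {}" by (metis finite.emptyI)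
  then obtain y where "y \<in> G" "y \<noteq> x" by blast
  moreover have "(adj E)\<^sup>*\<^sup>* x y" using conn assms \<open>y \<in> G\<close> by (simp add: connected_graph_def)
  ultimately obtain z where "adj E x z" by (metis converse_rtranclpE)
  then show ?thesis by blast
qed

lemma vdeg_pos: "x \<in> G \<Longrightarrow> vdeg E x \<ge> 1"
  using nbrs_nonempty[of x] finite_nbrs[of x] by (simp add: Suc_le_eq card_gt_0_iff flip: card_nbrs)

lemma relpow_dist:
  assumes "y \<in> G"
  shows "(adj E ^^ graph_dist E v y) v y"
proof -
  have "(adj E)\<^sup>*\<^sup>* v y" using conn root assms by (simp add: connected_graph_def)
  then obtain n where "(adj E ^^ n) v y" using rtranclp_imp_relpowp by metis
  then show ?thesis unfolding graph_dist_def by (rule LeastI)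
qed

lemma dist_le: "(adj E ^^ n) v y \<Longrightarrow> graph_dist E v y \<le> n"
  unfolding graph_dist_def by (rule Least_le)

text \<open>A prefix of a shortest path bounds the distance of its end from above; followed by the
  remaining suffix, a shorter way to that vertex would shorten the whole path. That the distance
  grows by one per step keeps geodesics inside balls and makes their edges distinct.\<close>

lemma geodesic:
  assumes "y \<in> G"
  shows "\<exists>p. p 0 = v \<and> p (graph_dist E v y) = y
    \<and> (\<forall>i<graph_dist E v y. adj E (p i) (p (Suc i)))
    \<and> (\<forall>i\<le>graph_dist E v y. p i \<in> G \<and> graph_dist E v (p i) = i)"
proof -
  let ?n = "graph_dist E v y"
  have "\<exists>p. p 0 = v \<and> p ?n = y \<and> (\<forall>i<?n. adj E (p i) (p (Suc i)))"
    using relpow_dist[OF assms] by (simp only: relpowp_fun_conv)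
  then obtain p where "p 0 = v \<and> p ?n = y \<and> (\<forall>i<?n. adj E (p i) (p (Suc i)))" ..
  then have p: "p 0 = v" "p ?n = y" "\<And>i. i < ?n \<Longrightarrow> adj E (p i) (p (Suc i))" by simp_all
  have G: "p i \<in> G" if "i \<le> ?n" for i
    using p(3)[of i, THEN adjD(1)] p(2) assms that by (cases "i = ?n") simp_all
  have 1: "(adj E ^^ (j - i)) (p i) (p j)" if "i \<le> j" "j \<le> ?n" for i j
  proof -
    have "p (i + 0) = p i" "p (i + (j - i)) = p j" "\<forall>l<j - i. adj E (p (i + l)) (p (i + Suc l))"
      using that p(3) by auto
    then show ?thesis unfolding relpowp_fun_conv by (intro exI[of _ "\<lambda>l. p (i + l)"] conjI)
  qed
  have d: "graph_dist E v (p i) = i" if i: "i \<le> ?n" for i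
  proof (rule antisym)
    have "(adj E ^^ i) v (p i)" using 1[of 0 i] p(1) i by simp
    then show "graph_dist E v (p i) \<le> i" by (rule dist_le)
    have "(adj E ^^ (?n - i)) (p i) y" using 1[OF i order_refl] p(2) by simp
    with relpow_dist[OF G[OF i]] have "(adj E ^^ (graph_dist E v (p i) + (?n - i))) v y"
      unfolding relpowp_add by (rule relcomppI)
    from dist_le[OF this] show "i \<le> graph_dist E v (p i)" using i by simp
  qed
  show ?thesis using p G d by (intro exI[of _ p]) simp
qed

lemma finite_dist_le: "finite {y \<in> G. graph_dist E v y \<le> n}"
proof (induction n)
  case 0
  have "y = v" if "y \<in> G" "graph_dist E v y = 0" for y
    using relpow_dist[OF that(1)] that(2) by simp
  then have "{y \<in> G. graph_dist E v y \<le> 0} \<subseteq> {v}" by auto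
  then show ?case by (rule finite_subset) simp
next
  case (Suc n)
  let ?S = "{y \<in> G. graph_dist E v y \<le> n}"
  have "{y \<in> G. graph_dist E v y \<le> Suc n} \<subseteq> ?S \<union> (\<Union>z\<in>?S. {y. adj E z y})"
  proof
    fix y assume y: "y \<in> {y \<in> G. graph_dist E v y \<le> Suc n}"
    show "y \<in> ?S \<union> (\<Union>z\<in>?S. {y. adj E z y})"
    proof (cases "graph_dist E v y \<le> n")
      case False
      with y have eq: "graph_dist E v y = Suc n" by simp
      from y have "y \<in> G" by simp
      from geodesic[OF this] eq obtain p where p: "p (Suc n) = y"
        "\<forall>i<Suc n. adj E (p i) (p (Suc i))"
        "\<forall>i\<le>Suc n. p i \<in> G \<and> graph_dist E v (p i) = i"
        by (elim exE conjE) simp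
      have "adj E (p n) y" using p(1,2) by auto
      moreover have "p n \<in> ?S" using p(3) by simp
      ultimately show ?thesis by blast
    qed (use y in auto)
  qed
  moreover have "finite (?S \<union> (\<Union>z\<in>?S. {y. adj E z y}))"
    using Suc by (simp add: finite_nbrs)
  ultimately show ?case by (rule finite_subset)
qed

lemma finite_ball: "finite (graph_ball G E v R)"
proof -
  obtain n where "R < real n" using reals_Archimedean2 by blast
  then have "graph_ball G E v R \<subseteq> {y \<in> G. graph_dist E v y \<le> n}"
    by (auto simp: graph_ball_def)
  then show ?thesis using finite_dist_le by (rule finite_subset)
qed

lemma ball_subset: "graph_ball G E v R \<subseteq> G"
  by (auto simp: graph_ball_def)

lemma dist_root: "graph_dist E v v = 0"
proof -
  have "(adj E ^^ 0) v v" by simp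
  from dist_le[OF this] show ?thesis by simp
qed

lemma root_in_ball: "R > 0 \<Longrightarrow> v \<in> graph_ball G E v R"
  using root dist_root by (simp add: graph_ball_def)

end

section \<open>The killed walk, its Green function and the Dirichlet form\<close>

definition step :: "'v set set \<Rightarrow> 'v \<Rightarrow> 'v \<Rightarrow> real" where
  "step E w z = (if adj E w z then 1 / real (vdeg E w) else 0)"

text \<open>A transition probability only for a final vertex in \<open>A\<close>: the last step is not required to stay in \<open>A\<close>.\<close>

fun killed :: "'v set set \<Rightarrow> 'v set \<Rightarrow> nat \<Rightarrow> 'v \<Rightarrow> 'v \<Rightarrow> real" where
  "killed E A 0 x y = (if x = y then 1 else 0)"
| "killed E A (Suc m) x y = (\<Sum>w\<in>A. killed E A m x w * step E w y)"

lemma step_nonneg: "step E w z \<ge> 0"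
  by (simp add: step_def)

lemma killed_nonneg: "killed E A m x y \<ge> 0"
  by (induction m arbitrary: y) (simp_all add: sum_nonneg step_nonneg)

text \<open>Divided by the degree, so that summation by parts applies; extended by \<open>0\<close> outside \<open>A\<close>.\<close>

definition green :: "'v set set \<Rightarrow> 'v set \<Rightarrow> nat \<Rightarrow> 'v \<Rightarrow> 'v \<Rightarrow> real" where
  "green E A n x y = (if y \<in> A then (\<Sum>k<n. killed E A k x y) / real (vdeg E y) else 0)"

lemma green_nonneg: "green E A n x y \<ge> 0"
  by (auto simp: green_def intro!: divide_nonneg_nonneg sum_nonneg killed_nonneg)

text \<open>A real-valued, polarized version of \<open>energy\<close> on the edges inside
  \<open>B\<close>. It is used for finite \<open>B\<close>, where no summability is at stake;
  ordered pairs again account for the division by 2.\<close>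

definition dform :: "'v set set \<Rightarrow> 'v set \<Rightarrow> ('v \<Rightarrow> real) \<Rightarrow> ('v \<Rightarrow> real) \<Rightarrow> real" where
  "dform E B f g = (\<Sum>(y, z)\<in>{(y, z). y \<in> B \<and> z \<in> B \<and> adj E y z}. (f y - f z) * (g y - g z)) / 2"

lemma dform_nonneg: "dform E B f f \<ge> 0"
  by (auto simp: dform_def intro!: sum_nonneg)

lemma dform_Cauchy_Schwarz: "\<bar>dform E B f g\<bar> \<le> sqrt (dform E B f f) * sqrt (dform E B g g)"
proof -
  let ?P = "{(y, z). y \<in> B \<and> z \<in> B \<and> adj E y z}"
  let ?d = "\<lambda>f e. f (fst e) - f (snd e) :: real"
  have dform: "dform E B f g = (\<Sum>e\<in>?P. ?d f e * ?d g e) / 2" for f g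
    unfolding dform_def by (simp add: case_prod_unfold)
  have "\<bar>\<Sum>e\<in>?P. ?d f e * ?d g e\<bar> \<le> (\<Sum>e\<in>?P. \<bar>?d f e\<bar> * \<bar>?d g e\<bar>)"
    by (rule order_trans[OF sum_abs]) (simp add: abs_mult)
  also have "\<dots> \<le> L2_set (?d f) ?P * L2_set (?d g) ?P"
    by (rule L2_set_mult_ineq)
  also have "\<dots> = sqrt (\<Sum>e\<in>?P. ?d f e * ?d f e) * sqrt (\<Sum>e\<in>?P. ?d g e * ?d g e)"
    by (simp add: L2_set_def power2_eq_square)
  also have "\<dots> = 2 * (sqrt (dform E B f f) * sqrt (dform E B g g))"
    unfolding dform by (simp add: real_sqrt_divide)
  finally show ?thesis unfolding dform[of f g] by simp
qed

section \<open>Energy and Green functions\<close>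

lemma ennreal_inverse_antimono:
  fixes a b :: ennreal
  assumes "a \<le> b"
  shows "inverse b \<le> inverse a"
proof (cases "a = 0 \<or> b = top")
  case False
  with assms have "0 < a" "b < top" by (auto simp: zero_less_iff_neq_zero less_top)
  then obtain r s where "a = ennreal r" "b = ennreal s" "0 < r"
    using assms by (cases a rule: ennreal_cases; cases b rule: ennreal_cases) (auto simp: top_unique)
  with assms show ?thesis by (simp add: inverse_ennreal ennreal_le_iff2 ennreal_leI le_imp_inverse_le)
qed auto

context rooted_graph begin

text \<open>A function vanishing off \<open>A\<close> still varies along the edges that leave
  \<open>A\<close>. Both ends of all these edges lie in \<open>nbhd A\<close>, so
  \<open>dform\<close> on it sees the whole energy of such a function.\<close>

definition nbhd :: "'v set \<Rightarrow> 'v set" where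
  "nbhd A = A \<union> (\<Union>x\<in>A. {y. adj E x y})"

lemma finite_nbhd: "finite A \<Longrightarrow> finite (nbhd A)"
  by (simp add: nbhd_def finite_nbrs)

lemma subset_nbhd: "A \<subseteq> nbhd A"
  by (simp add: nbhd_def)

lemma nbhd_subset: "A \<subseteq> G \<Longrightarrow> nbhd A \<subseteq> G"
  by (auto simp: nbhd_def dest: adjD(2))

text \<open>Expanding the product over all pairs and exchanging the summation variables collapses
  four sums to two, as adjacency is symmetric. The full degree appears because \<open>nbhd A\<close>
  contains every neighbour of a vertex of \<open>A\<close>. The bracket is the negative graph
  Laplacian of \<open>g\<close>.\<close>

lemma dform_by_parts:
  assumes A: "finite A" and f: "\<And>y. y \<notin> A \<Longrightarrow> f y = 0" and g: "\<And>y. y \<notin> A \<Longrightarrow> g y = 0"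
  shows "dform E (nbhd A) f g
    = (\<Sum>y\<in>A. f y * (real (vdeg E y) * g y - (\<Sum>w\<in>A. if adj E y w then g w else 0)))"
proof -
  let ?B = "nbhd A"
  define c where "c y z = (if adj E y z then 1 else 0 :: real)" for y z
  have c_sym: "c y z = c z y" for y z by (simp add: c_def adj_commute)
  have B: "finite ?B" "A \<subseteq> ?B" using A finite_nbhd subset_nbhd by auto
  have deg: "(\<Sum>z\<in>?B. c y z) = real (vdeg E y)" if "y \<in> A" for y
  proof -
    have "?B \<inter> {z. adj E y z} = {z. adj E y z}" using that by (auto simp: nbhd_def)
    then show ?thesis unfolding c_def
      by (simp add: sum.If_cases B(1) card_nbrs)
  qed
  have restr: "(\<Sum>z\<in>?B. c y z * g z) = (\<Sum>w\<in>A. if adj E y w then g w else 0)" for y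
    unfolding c_def by (rule sum.mono_neutral_cong_right[OF B]) (auto simp: g)
  have "2 * dform E ?B f g = (\<Sum>(y, z)\<in>?B \<times> ?B. c y z * ((f y - f z) * (g y - g z)))"
    unfolding dform_def
    by (simp, rule sum.mono_neutral_cong_left) (auto simp: B c_def split: if_splits)
  also have "\<dots> = (\<Sum>y\<in>?B. \<Sum>z\<in>?B. c y z * ((f y - f z) * (g y - g z)))"
    by (simp add: sum.cartesian_product)
  also have "\<dots> = (\<Sum>y\<in>?B. \<Sum>z\<in>?B. c y z * (f y * g y)) - (\<Sum>y\<in>?B. \<Sum>z\<in>?B. c y z * (f y * g z))
     - (\<Sum>y\<in>?B. \<Sum>z\<in>?B. c y z * (f z * g y)) + (\<Sum>y\<in>?B. \<Sum>z\<in>?B. c y z * (f z * g z))"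
    by (simp add: algebra_simps sum.distrib sum_subtractf)
  also have "(\<Sum>y\<in>?B. \<Sum>z\<in>?B. c y z * (f z * g y)) = (\<Sum>y\<in>?B. \<Sum>z\<in>?B. c y z * (f y * g z))"
    by (subst sum.swap) (simp add: c_sym)
  also have "(\<Sum>y\<in>?B. \<Sum>z\<in>?B. c y z * (f z * g z)) = (\<Sum>y\<in>?B. \<Sum>z\<in>?B. c y z * (f y * g y))"
    by (subst sum.swap) (simp add: c_sym)
  finally have "dform E ?B f g
    = (\<Sum>y\<in>?B. \<Sum>z\<in>?B. c y z * (f y * g y)) - (\<Sum>y\<in>?B. \<Sum>z\<in>?B. c y z * (f y * g z))"
    by simp
  also have "\<dots> = (\<Sum>y\<in>?B. f y * ((\<Sum>z\<in>?B. c y z) * g y - (\<Sum>z\<in>?B. c y z * g z)))"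
    by (simp add: sum_subtractf[symmetric] sum_distrib_left sum_distrib_right algebra_simps)
  also have "\<dots> = (\<Sum>y\<in>A. f y * (real (vdeg E y) * g y - (\<Sum>z\<in>?B. c y z * g z)))"
    by (rule sum.mono_neutral_cong_right[OF B]) (auto simp: f deg)
  finally show ?thesis by (simp add: restr)
qed

text \<open>The Laplacian moves the killed walk on by one step, so on the Green function it acts as
  a difference in time. The sum over times telescopes to the point mass at \<open>x\<close> minus
  the killed law at time \<open>n\<close>.\<close>

lemma dform_green:
  assumes A: "finite A" "A \<subseteq> G" and x: "x \<in> A" and f: "\<And>y. y \<notin> A \<Longrightarrow> f y = 0"
  shows "dform E (nbhd A) f (green E A n x) = f x - (\<Sum>y\<in>A. f y * killed E A n x y)"
proof -
  let ?h = "green E A n x"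
  have *: "real (vdeg E y) * ?h y - (\<Sum>w\<in>A. if adj E y w then ?h w else 0)
      = (if x = y then 1 else 0) - killed E A n x y" if y: "y \<in> A" for y
  proof -
    have "real (vdeg E y) * ?h y = (\<Sum>k<n. killed E A k x y)"
      using vdeg_pos[of y] y A(2) by (auto simp: green_def)
    \<comment> \<open>Dividing by the degree of \<open>w\<close> turns the value at the neighbour
      \<open>w\<close> into a step from \<open>w\<close> to \<open>y\<close>, by symmetry of
      adjacency.\<close>
    moreover have "(\<Sum>w\<in>A. if adj E y w then ?h w else 0) = (\<Sum>w\<in>A. \<Sum>k<n. killed E A k x w * step E w y)"
      by (intro sum.cong) (auto simp: green_def step_def adj_commute sum_divide_distrib)
    moreover have "\<dots> = (\<Sum>k<n. killed E A (Suc k) x y)"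
      by (subst sum.swap) simp
    ultimately have "real (vdeg E y) * ?h y - (\<Sum>w\<in>A. if adj E y w then ?h w else 0)
      = (\<Sum>k<n. killed E A k x y - killed E A (Suc k) x y)"
      by (simp only: sum_subtractf)
    also have "\<dots> = killed E A 0 x y - killed E A n x y"
      by (rule sum_lessThan_telescope')
    finally show ?thesis by simp
  qed
  have "dform E (nbhd A) f ?h = (\<Sum>y\<in>A. f y * ((if x = y then 1 else 0) - killed E A n x y))"
  proof -
    have "?h y = 0" if "y \<notin> A" for y using that by (simp add: green_def)
    then show ?thesis using dform_by_parts[OF A(1) f, where g = ?h] by (simp add: * cong: sum.cong)
  qed
  also have "\<dots> = (\<Sum>y\<in>A. if x = y then f y else 0) - (\<Sum>y\<in>A. f y * killed E A n x y)"
    unfolding sum_subtractf[symmetric] by (intro sum.cong) (simp_all add: algebra_simps)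
  finally show ?thesis using x A(1) by simp
qed

lemma green_energy_le:
  assumes "finite A" "A \<subseteq> G" "x \<in> A"
  shows "dform E (nbhd A) (green E A n x) (green E A n x) \<le> green E A n x x"
proof -
  have "(\<Sum>y\<in>A. green E A n x y * killed E A n x y) \<ge> 0"
    by (intro sum_nonneg mult_nonneg_nonneg green_nonneg killed_nonneg)
  then show ?thesis using assms by (subst dform_green) (simp_all add: green_def)
qed

lemma sum_step_le: "finite A \<Longrightarrow> (\<Sum>y\<in>A. step E w y) \<le> 1"
proof -
  assume A: "finite A"
  have "(\<Sum>y\<in>A. step E w y) = real (card (A \<inter> {y. adj E w y})) / real (vdeg E w)"
    unfolding step_def by (simp add: sum.If_cases A)
  also have "\<dots> \<le> 1"
    using card_mono[OF finite_nbrs, of "A \<inter> {y. adj E w y}" w]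
    by (simp add: card_nbrs divide_le_eq_1) linarith
  finally show ?thesis .
qed

lemma sum_killed_le:
  assumes A: "finite A"
  shows "(\<Sum>y\<in>A. killed E A m x y) \<le> 1"
proof (induction m)
  case 0
  then show ?case using A by (simp add: sum.delta)
next
  case (Suc m)
  have "(\<Sum>y\<in>A. killed E A (Suc m) x y) = (\<Sum>w\<in>A. killed E A m x w * (\<Sum>y\<in>A. step E w y))"
    by (simp add: sum_distrib_left) (rule sum.swap)
  also have "\<dots> \<le> (\<Sum>w\<in>A. killed E A m x w * 1)"
    by (intro sum_mono mult_left_mono sum_step_le A killed_nonneg)
  finally show ?case using Suc by simp
qed

text \<open>Telescope along a geodesic and apply the Cauchy--Schwarz inequality. The geodesic stays
  in the ball, and the distances to the root tell its edges apart, so its contribution is part of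
  the sum in \<open>dform\<close>. Using each edge in one direction only costs the factor 2.\<close>

lemma diff_root_le:
  assumes y: "y \<in> graph_ball G E v R" and B: "graph_ball G E v R \<subseteq> B" "finite B"
  shows "(f y - f v)\<^sup>2 \<le> 2 * real (graph_dist E v y) * dform E B f f"
proof -
  let ?n = "graph_dist E v y"
  have "y \<in> G" using y ball_subset by blast
  from geodesic[OF this] obtain p where p: "p 0 = v" "p ?n = y"
    "\<forall>i<?n. adj E (p i) (p (Suc i))"
    "\<forall>i\<le>?n. p i \<in> G \<and> graph_dist E v (p i) = i"
    by (elim exE conjE) simp
  let ?P = "{(y, z). y \<in> B \<and> z \<in> B \<and> adj E y z}"
  let ?q = "\<lambda>i. (p (Suc i), p i)"
  have pB: "p i \<in> B" if "i \<le> ?n" for i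
  proof -
    have "real i < R" using that y by (simp add: graph_ball_def)
    then have "p i \<in> graph_ball G E v R" using p(4) that by (simp add: graph_ball_def)
    then show ?thesis using B by blast
  qed
  have "finite ?P" by (rule finite_subset[of _ "B \<times> B"]) (auto simp: B)
  have inj: "inj_on ?q {..<?n}"
  proof (rule inj_onI)
    fix i j assume ij: "i \<in> {..<?n}" "j \<in> {..<?n}" "?q i = ?q j"
    then have "graph_dist E v (p i) = graph_dist E v (p j)" by simp
    then show "i = j" using p(4) ij by (metis lessThan_iff less_imp_le prod.inject)
  qed
  have sub: "?q ` {..<?n} \<subseteq> ?P" using pB p(3) by (auto intro: adj_sym)
  have "f y - f v = (\<Sum>i<?n. f (p (Suc i)) - f (p i))"
    using sum_lessThan_telescope[of "\<lambda>i. f (p i)" ?n] p(1,2) by simp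
  also have "\<dots>\<^sup>2 \<le> (\<Sum>i<?n. 1\<^sup>2) * (\<Sum>i<?n. (f (p (Suc i)) - f (p i))\<^sup>2)"
    using Cauchy_Schwarz_ineq_sum[of "\<lambda>_. 1" "\<lambda>i. f (p (Suc i)) - f (p i)" "{..<?n}"] by simp
  also have "(\<Sum>i<?n. (f (p (Suc i)) - f (p i))\<^sup>2) = (\<Sum>(y, z)\<in>?q ` {..<?n}. (f y - f z) * (f y - f z))"
    by (simp add: sum.reindex[OF inj] power2_eq_square)
  also have "\<dots> \<le> (\<Sum>(y, z)\<in>?P. (f y - f z) * (f y - f z))"
    by (rule sum_mono2[OF \<open>finite ?P\<close> sub]) auto
  also have "\<dots> = 2 * dform E B f f" by (simp add: dform_def)
  finally show ?thesis by (simp add: mult_left_mono)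
qed

lemma vol_ball_pos: "r > 0 \<Longrightarrow> vol E (graph_ball G E v r) > 0"
  unfolding vol_def using finite_ball root_in_ball vdeg_pos[OF root]
  by (intro sum_pos2[of _ v]) auto


text \<open>Some vertex \<open>y\<close> of the small ball carries at most the average mass
  \<open>n / V(r)\<close>. Both \<open>x\<close> and \<open>y\<close> are within \<rho> of the root,
  so the energy bound gives a difference of order sqrt (\<rho> * h x), part of which is absorbed
  into the left-hand side. The radii are kept separate: a start near the root takes \<open>r\<close>
  much smaller than \<open>R\<close>, an arbitrary vertex of the ball needs
  \<open>r = \<rho> = R\<close>.\<close>

lemma green_diag_le:
  assumes x: "x \<in> graph_ball G E v R" and r: "0 < r" "r \<le> R" "r \<le> \<rho>"
    and \<rho>: "real (graph_dist E v x) \<le> \<rho>"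
  defines "A \<equiv> graph_ball G E v R"
  shows "green E A n x x \<le> 2 * real n / vol E (graph_ball G E v r) + 8 * \<rho>"
proof -
  let ?h = "green E A n x" and ?V = "vol E (graph_ball G E v r)"
  have A: "finite A" "A \<subseteq> G" "x \<in> A" using finite_ball ball_subset x by (auto simp: A_def)
  have sub: "graph_ball G E v r \<subseteq> A" using r by (auto simp: A_def graph_ball_def)
  have V: "?V > 0" using vol_ball_pos r by simp
  have energy: "dform E (nbhd A) ?h ?h \<le> ?h x" by (rule green_energy_le[OF A])
  have diff: "(?h y - ?h v)\<^sup>2 \<le> 2 * \<rho> * ?h x" if "y \<in> A" "real (graph_dist E v y) \<le> \<rho>" for y
  proof -
    have "(?h y - ?h v)\<^sup>2 \<le> 2 * real (graph_dist E v y) * dform E (nbhd A) ?h ?h"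
      using that(1) by (intro diff_root_le[where R = R]) (simp_all add: A_def finite_ball finite_nbhd subset_nbhd)
    also have "\<dots> \<le> 2 * \<rho> * ?h x"
      using energy that(2) by (intro mult_mono) (auto simp: dform_nonneg)
    finally show ?thesis .
  qed
  \<comment> \<open>the total mass of the Green function is at most \<open>n\<close>\<close>
  have "\<exists>y\<in>graph_ball G E v r. ?h y \<le> real n / ?V"
  proof (rule ccontr)
    assume "\<not> ?thesis"
    then have *: "real n / ?V < ?h y" if "y \<in> graph_ball G E v r" for y using that by force
    have "real n = (\<Sum>y\<in>graph_ball G E v r. real (vdeg E y) * (real n / ?V))"
      unfolding sum_distrib_right[symmetric] vol_def[symmetric] using V by simp
    also have "\<dots> < (\<Sum>y\<in>graph_ball G E v r. real (vdeg E y) * ?h y)"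
      using * vdeg_pos ball_subset[of r] root_in_ball[OF r(1)]
      by (intro sum_strict_mono finite_ball mult_strict_left_mono) (force simp: subset_iff)+
    also have "\<dots> \<le> (\<Sum>y\<in>A. real (vdeg E y) * ?h y)"
      by (intro sum_mono2 A sub mult_nonneg_nonneg green_nonneg) simp
    also have "\<dots> = (\<Sum>y\<in>A. \<Sum>k<n. killed E A k x y)"
      using vdeg_pos A(2) by (intro sum.cong) (force simp: green_def subset_iff)+
    also have "\<dots> = (\<Sum>k<n. \<Sum>y\<in>A. killed E A k x y)" by (rule sum.swap)
    also have "\<dots> \<le> (\<Sum>k<n. 1)" by (intro sum_mono sum_killed_le A)
    finally show False by simp
  qed
  then obtain y where y: "y \<in> graph_ball G E v r" "?h y \<le> real n / ?V" by blast
  have "real (graph_dist E v y) \<le> \<rho>" using y(1) r(3) by (simp add: graph_ball_def)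
  then have "(?h y - ?h v)\<^sup>2 \<le> 2 * \<rho> * ?h x" "(?h x - ?h v)\<^sup>2 \<le> 2 * \<rho> * ?h x"
    using diff[of y] diff[of x] y(1) sub A \<rho> by auto
  moreover have "(?h x - ?h y)\<^sup>2 \<le> 2 * (?h x - ?h v)\<^sup>2 + 2 * (?h y - ?h v)\<^sup>2"
    using zero_le_power2[of "?h x + ?h y - 2 * ?h v"] by (simp add: power2_eq_square algebra_simps)
  ultimately have 1: "(?h x - ?h y)\<^sup>2 \<le> 8 * \<rho> * ?h x" by simp
  \<comment> \<open>Arithmetic-geometric mean with weights that leave only half of
    \<open>h x\<close> on the right; solving for \<open>h x\<close> doubles the remaining
    terms.\<close>
  also have "\<dots> \<le> (?h x / 2 + 4 * \<rho>)\<^sup>2"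
    using zero_le_power2[of "?h x / 2 - 4 * \<rho>"] by (simp add: power2_eq_square algebra_simps)
  finally have "?h x - ?h y \<le> ?h x / 2 + 4 * \<rho>"
    by (rule power2_le_imp_le) (use r green_nonneg[of E A n x x] in auto)
  with y(2) show ?thesis by simp
qed

text \<open>By \<open>dform_green\<close> the form of \<open>f\<close> and the Green function is
  \<open>f x\<close> minus the mean of \<open>f\<close> under the killed law at time
  \<open>n\<close>, and by Cauchy--Schwarz it is small. As \<open>f \<le> 1\<close>, that mean is at
  most the surviving mass, while \<open>f x\<close> is close to \<open>f v = 1\<close> because
  \<open>f\<close> has small energy.\<close>

lemma survival_ge:
  assumes x: "x \<in> graph_ball G E v R" and f: "f v = 1" "\<And>y. f y \<le> 1"
  defines "A \<equiv> graph_ball G E v R"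
  assumes f0: "\<And>y. y \<notin> A \<Longrightarrow> f y = 0"
    and e: "dform E (nbhd A) f f \<le> e"
  shows "(\<Sum>y\<in>A. killed E A n x y) \<ge> 1 - sqrt (2 * real (graph_dist E v x) * e) - sqrt (e * green E A n x x)"
proof -
  let ?h = "green E A n x"
  have A: "finite A" "A \<subseteq> G" "x \<in> A" using finite_ball ball_subset x by (auto simp: A_def)
  have "(f x - f v)\<^sup>2 \<le> 2 * real (graph_dist E v x) * dform E (nbhd A) f f"
    using A by (intro diff_root_le[where R = R]) (simp_all add: A_def finite_ball finite_nbhd subset_nbhd)
  also have "\<dots> \<le> 2 * real (graph_dist E v x) * e" using e by (simp add: mult_left_mono)
  finally have "\<bar>f x - f v\<bar> \<le> sqrt (2 * real (graph_dist E v x) * e)"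
    by (simp add: real_le_rsqrt)
  then have 1: "f x \<ge> 1 - sqrt (2 * real (graph_dist E v x) * e)" using f(1) by simp
  have "\<bar>dform E (nbhd A) f ?h\<bar> \<le> sqrt (dform E (nbhd A) f f) * sqrt (dform E (nbhd A) ?h ?h)"
    by (rule dform_Cauchy_Schwarz)
  also have "\<dots> \<le> sqrt e * sqrt (?h x)"
    using e green_energy_le[OF A, of n] order_trans[OF dform_nonneg e]
    by (intro mult_mono) (auto simp: dform_nonneg green_nonneg)
  finally have 2: "f x - (\<Sum>y\<in>A. f y * killed E A n x y) \<le> sqrt (e * ?h x)"
    using dform_green[OF A f0, where n = n] by (simp add: real_sqrt_mult)
  have "(\<Sum>y\<in>A. f y * killed E A n x y) \<le> (\<Sum>y\<in>A. 1 * killed E A n x y)"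
    by (intro sum_mono mult_right_mono f killed_nonneg)
  with 1 2 show ?thesis by simp
qed

lemma dform_le_energy:
  assumes "finite B"
  shows "ennreal (dform E B f f) \<le> energy E f"
proof -
  let ?P = "{(y, z). y \<in> B \<and> z \<in> B \<and> adj E y z}"
  let ?g = "\<lambda>(x, y). ennreal ((f x - f y)\<^sup>2)"
  have "finite ?P" by (rule finite_subset[of _ "B \<times> B"]) (auto simp: assms)
  have "ennreal (dform E B f f) = ennreal (\<Sum>(y, z)\<in>?P. (f y - f z)\<^sup>2) / 2"
    unfolding dform_def power2_eq_square
    by (subst divide_ennreal[symmetric]) (auto intro!: sum_nonneg)
  also have "ennreal (\<Sum>(y, z)\<in>?P. (f y - f z)\<^sup>2) = sum ?g ?P"
    by (subst sum_ennreal[symmetric]) (auto intro!: sum.cong)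
  also have "\<dots> = infsum ?g ?P" using \<open>finite ?P\<close> by simp
  also have "\<dots> \<le> infsum ?g {(x, y). adj E x y}"
    by (rule infsum_mono_neutral) (auto intro: nonneg_summable_on_complete)
  finally show ?thesis by (simp add: energy_def divide_right_mono_ennreal)
qed

text \<open>The factor 2 makes the bound on the infimum strict, so some admissible function meets it
  without an argument for a minimiser. Capping at 1 does not increase differences.\<close>

lemma eff_resistance_potential:
  assumes R: "R > 0" "l > 0"
  defines "A \<equiv> graph_ball G E v R"
  assumes res: "eff_resistance E {v} (G - A) \<ge> ennreal (R / l)"
  obtains f where "f v = 1" "\<And>y. f y \<le> 1" "\<And>y. y \<notin> A \<Longrightarrow> f y = 0"
    "dform E (nbhd A) f f \<le> 2 * l / R"
proof -
  let ?S = "{energy E f |f. energy E f < \<infinity> \<and> (\<forall>a\<in>{v}. f a = 1) \<and> (\<forall>b\<in>G - A. f b = 0)}"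
  have "Inf ?S < ennreal (2 * l / R)"
  proof (rule ccontr)
    assume "\<not> ?thesis"
    then have "inverse (Inf ?S) \<le> inverse (ennreal (2 * l / R))"
      by (intro ennreal_inverse_antimono) simp
    also have "\<dots> = ennreal (R / (2 * l))" using R by (simp add: inverse_ennreal)
    also have "\<dots> < ennreal (R / l)" using R by (simp add: ennreal_lessI field_simps)
    finally show False using res by (simp add: eff_resistance_def)
  qed
  then obtain f where f: "energy E f < ennreal (2 * l / R)" "f v = 1" "\<And>b. b \<in> G - A \<Longrightarrow> f b = 0"
    by (auto simp: Inf_less_iff)
  \<comment> \<open>outside \<open>G\<close> the function \<open>f\<close> is arbitrary\<close>
  define g where "g y = (if y \<in> A then min 1 (f y) else 0)" for y
  have A: "A \<subseteq> G" "finite A" "v \<in> A" using ball_subset finite_ball root_in_ball R by (auto simp: A_def)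
  have gf: "g y = min 1 (f y)" if "y \<in> G" for y using f(3) that by (auto simp: g_def)
  have "dform E (nbhd A) g g \<le> dform E (nbhd A) f f"
  proof -
    have "(g y - g z)\<^sup>2 \<le> (f y - f z)\<^sup>2" if "y \<in> nbhd A" "z \<in> nbhd A" for y z
    proof (rule abs_le_square_iff[THEN iffD1])
      have "y \<in> G" "z \<in> G" using nbhd_subset[OF A(1)] that by auto
      then show "\<bar>g y - g z\<bar> \<le> \<bar>f y - f z\<bar>" by (simp add: gf min_def)
    qed
    then show ?thesis
      unfolding dform_def by (auto intro!: divide_right_mono sum_mono simp: power2_eq_square)
  qed
  moreover have "ennreal (dform E (nbhd A) f f) < ennreal (2 * l / R)"
    using dform_le_energy[OF finite_nbhd[OF A(2)], of f] f(1) by simp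
  then have "dform E (nbhd A) f f < 2 * l / R" by (simp add: ennreal_less_iff dform_nonneg)
  ultimately have "dform E (nbhd A) g g \<le> 2 * l / R" by simp
  then show thesis using that[of g] A f(2) by (auto simp: g_def)
qed

end

section \<open>Path probabilities\<close>

lemma measurable_srw_coord [measurable]: "(\<lambda>X. X i) \<in> measurable (srw E x) (count_space UNIV)"
proof -
  have "(\<lambda>X. X i) \<in> measurable (PiM UNIV (\<lambda>_. count_space UNIV)) (count_space (UNIV :: 'a set))"
    by (rule measurable_component_singleton) simp
  then show ?thesis by (subst measurable_cong_sets[OF sets_srw refl])
qed

lemma sets_srw_coord: "{X. P (X i)} \<in> sets (srw E x)"
proof -
  have "(\<lambda>X. X i) -` Collect P \<inter> space (srw E x) \<in> sets (srw E x)"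
    by (rule measurable_sets[OF measurable_srw_coord]) simp
  then show ?thesis by (simp add: space_srw vimage_def)
qed

definition cyl :: "nat \<Rightarrow> (nat \<Rightarrow> 'v) \<Rightarrow> (nat \<Rightarrow> 'v) set" where
  "cyl n y = {X. \<forall>i<n. X i = y i}"

lemma sets_cyl: "cyl n y \<in> sets (srw E x)"
proof (induction n)
  case 0
  have "cyl 0 y = space (srw E x)" by (simp add: cyl_def space_srw)
  then show ?case by simp
next
  case (Suc n)
  have "cyl (Suc n) y = cyl n y \<inter> {X. X n = y n}" by (auto simp: cyl_def less_Suc_eq)
  then show ?case using Suc sets_srw_coord[of "\<lambda>w. w = y n" n] by simp
qed

definition determined_upto :: "nat \<Rightarrow> ((nat \<Rightarrow> 'v) \<Rightarrow> bool) \<Rightarrow> bool" where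
  "determined_upto n Q \<longleftrightarrow> (\<forall>X Y. (\<forall>l\<le>n. X l = Y l) \<longrightarrow> Q X = Q Y)"

lemma determined_uptoD: "determined_upto n Q \<Longrightarrow> (\<And>l. l \<le> n \<Longrightarrow> X l = Y l) \<Longrightarrow> Q X = Q Y"
  unfolding determined_upto_def by blast

text \<open>A path confined to a finite set has finitely many possible initial segments, so an event
  about its first positions is a finite union of disjoint cylinders. This gives measurability and
  probabilities without countability of the vertex type.\<close>

lemma confined_paths:
  fixes A :: "'v set"
  assumes "finite A" and Q: "determined_upto n Q"
  defines "F \<equiv> {y \<in> {..n} \<rightarrow>\<^sub>E A. Q y}"
  shows "finite F" and "disjoint_family_on (cyl (Suc n)) F"
    and "{X. Q X \<and> (\<forall>l\<le>n. X l \<in> A)} = (\<Union>y\<in>F. cyl (Suc n) y)"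
proof -
  show "finite F" using assms(1) by (simp add: F_def finite_PiE)
  show "disjoint_family_on (cyl (Suc n)) F"
    unfolding disjoint_family_on_def
  proof (intro ballI impI)
    fix y z assume yz: "y \<in> F" "z \<in> F" "y \<noteq> z"
    show "cyl (Suc n) y \<inter> cyl (Suc n) z = {}"
    proof (rule ccontr)
      assume "cyl (Suc n) y \<inter> cyl (Suc n) z \<noteq> {}"
      then obtain X where "\<forall>i<Suc n. X i = y i" "\<forall>i<Suc n. X i = z i" by (auto simp: cyl_def)
      then have "\<forall>i\<in>{..n}. y i = z i" by (metis atMost_iff less_Suc_eq_le)
      moreover have "y \<in> {..n} \<rightarrow>\<^sub>E A" "z \<in> {..n} \<rightarrow>\<^sub>E A" using yz by (auto simp: F_def)
      ultimately have "y = z" by (metis PiE_ext)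
      with yz show False by simp
    qed
  qed
  show "{X. Q X \<and> (\<forall>l\<le>n. X l \<in> A)} = (\<Union>y\<in>F. cyl (Suc n) y)"
  proof (intro equalityI subsetI)
    fix X assume X: "X \<in> {X. Q X \<and> (\<forall>l\<le>n. X l \<in> A)}"
    have "Q (restrict X {..n}) = Q X" by (rule determined_uptoD[OF Q]) simp
    with X have "restrict X {..n} \<in> F" by (simp add: F_def restrict_PiE_iff)
    moreover have "X \<in> cyl (Suc n) (restrict X {..n})" by (simp add: cyl_def)
    ultimately show "X \<in> (\<Union>y\<in>F. cyl (Suc n) y)" by blast
  next
    fix X assume "X \<in> (\<Union>y\<in>F. cyl (Suc n) y)"
    then obtain y where y: "y \<in> F" "\<And>i. i \<le> n \<Longrightarrow> X i = y i" by (auto simp: cyl_def less_Suc_eq_le)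
    moreover have "Q X = Q y" by (rule determined_uptoD[OF Q y(2)])
    ultimately show "X \<in> {X. Q X \<and> (\<forall>l\<le>n. X l \<in> A)}" by (auto simp: F_def PiE_iff)
  qed
qed

lemma sets_confined:
  fixes A :: "'v set"
  assumes "finite A" and "determined_upto n Q"
  shows "{X. Q X \<and> (\<forall>l\<le>n. X l \<in> A)} \<in> sets (srw E x)"
proof -
  note paths = confined_paths[where Q = Q and n = n, OF assms]
  show ?thesis unfolding paths(3) by (intro sets.finite_UN paths(1) sets_cyl)
qed

context rooted_graph begin

lemma emeasure_srw_step:
  assumes "X m \<in> G"
  shows "emeasure (srw_step E x (Suc m) X) {z} = ennreal (step E (X m) z)"
  using pmf_of_set[OF nbrs_nonempty[OF assms] finite_nbrs, of z]
  by (simp add: srw_step_def emeasure_pmf_single card_nbrs step_def)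

lemma measure_cyl_Suc:
  assumes "y n \<in> G"
  shows "measure (srw E x) (cyl (Suc (Suc n)) (y(Suc n := z))) = measure (srw E x) (cyl (Suc n) y) * step E (y n) z"
proof -
  have "srw_step E x i (y(Suc n := z)) = srw_step E x i y" if "i < Suc n" for i
    using that by (cases i) (simp_all add: srw_step_def)
  then have "(\<Prod>i<Suc n. emeasure (srw_step E x i (y(Suc n := z))) {(y(Suc n := z)) i})
      = (\<Prod>i<Suc n. emeasure (srw_step E x i y) {y i})"
    by (intro prod.cong) simp_all
  then have "emeasure (srw E x) (cyl (Suc (Suc n)) (y(Suc n := z)))
      = emeasure (srw E x) (cyl (Suc n) y) * emeasure (srw_step E x (Suc n) (y(Suc n := z))) {z}"
    unfolding cyl_def emeasure_srw_cylinder by (subst prod.lessThan_Suc) simp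
  also have "emeasure (srw_step E x (Suc n) (y(Suc n := z))) {z} = ennreal (step E (y n) z)"
    using assms by (subst emeasure_srw_step) simp_all
  finally show ?thesis unfolding measure_def by (simp only: enn2real_mult enn2real_ennreal step_nonneg)
qed

text \<open>Split the event into the cylinders of \<open>confined_paths\<close>, with the condition
  \<open>X n = w\<close> absorbed into \<open>Q'\<close>, and extend each cylinder by one
  position.\<close>

lemma markov_step:
  assumes A: "finite A" "A \<subseteq> G" and Q: "determined_upto n Q"
  shows "measure (srw E x) {X. Q X \<and> (\<forall>l\<le>n. X l \<in> A) \<and> X n = w \<and> X (Suc n) = z}
    = measure (srw E x) {X. Q X \<and> (\<forall>l\<le>n. X l \<in> A) \<and> X n = w} * step E w z"
proof -
  interpret prob_space "srw E x" by (rule prob_space_srw)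
  define Q' where "Q' X \<longleftrightarrow> Q X \<and> X n = w" for X
  have Q': "determined_upto n Q'"
    using Q unfolding determined_upto_def Q'_def by (metis order_refl)
  define F where "F = {y \<in> {..n} \<rightarrow>\<^sub>E A. Q' y}"
  note F = confined_paths[where Q = Q' and n = n, OF A(1) Q', folded F_def]
  have yn: "y n = w" "w \<in> G" if "y \<in> F" for y
    using that A(2) by (auto simp: F_def Q'_def)
  let ?c = "\<lambda>y. cyl (Suc (Suc n)) (y(Suc n := z))"
  have "{X. Q X \<and> (\<forall>l\<le>n. X l \<in> A) \<and> X n = w \<and> X (Suc n) = z} = {X. Q' X \<and> (\<forall>l\<le>n. X l \<in> A)} \<inter> {X. X (Suc n) = z}"
    unfolding Q'_def by (intro set_eqI) (simp add: conj_ac)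
  also have "\<dots> = (\<Union>y\<in>F. cyl (Suc n) y \<inter> {X. X (Suc n) = z})" 
    unfolding F(3) by (subst Int_commute, subst Int_UN_distrib) (simp only: Int_commute)
  also have "\<dots> = (\<Union>y\<in>F. ?c y)"
    by (intro SUP_cong refl) (auto simp: cyl_def less_Suc_eq)
  finally have "measure (srw E x) {X. Q X \<and> (\<forall>l\<le>n. X l \<in> A) \<and> X n = w \<and> X (Suc n) = z} = measure (srw E x) (\<Union>y\<in>F. ?c y)"
    by simp
  also have "\<dots> = (\<Sum>y\<in>F. measure (srw E x) (?c y))"
  proof (rule finite_measure_finite_Union)
    have "?c y \<subseteq> cyl (Suc n) y" for y by (auto simp: cyl_def)
    then show "disjoint_family_on ?c F" using F(2) unfolding disjoint_family_on_def by blast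
  qed (use F(1) sets_cyl in auto)
  also have "\<dots> = (\<Sum>y\<in>F. measure (srw E x) (cyl (Suc n) y) * step E w z)"
    using yn by (intro sum.cong refl) (simp add: measure_cyl_Suc)
  also have "\<dots> = measure (srw E x) (\<Union>y\<in>F. cyl (Suc n) y) * step E w z"
    by (subst finite_measure_finite_Union[OF F(1) _ F(2)]) (auto simp: sets_cyl sum_distrib_right)
  also have "(\<Union>y\<in>F. cyl (Suc n) y) = {X. Q X \<and> (\<forall>l\<le>n. X l \<in> A) \<and> X n = w}"
    unfolding F(3)[symmetric] Q'_def by (intro set_eqI) (simp add: conj_ac)
  finally show ?thesis .
qed

text \<open>\<open>Q\<close> stands for an arbitrary past that ends at \<open>a\<close> at time
  \<open>i\<close>. It is used for the start \<open>X 0 = x\<close> in the survival bound and for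
  \<open>X i = z\<close> in the collision bound.\<close>

lemma markov_property:
  assumes A: "finite A" "A \<subseteq> G" and Q: "determined_upto i Q"
    and start: "\<And>X. Q X \<Longrightarrow> X i = a" and y: "y \<in> A"
  shows "measure (srw E x) {X. Q X \<and> (\<forall>l\<le>i + m. X l \<in> A) \<and> X (i + m) = y}
    = measure (srw E x) {X. Q X \<and> (\<forall>l\<le>i. X l \<in> A)} * killed E A m a y"
  using y
proof (induction m arbitrary: y)
  case 0
  show ?case
  proof (cases "a = y")
    case True
    then have "{X. Q X \<and> (\<forall>l\<le>i. X l \<in> A) \<and> X i = y} = {X. Q X \<and> (\<forall>l\<le>i. X l \<in> A)}"
      using start by blast
    then show ?thesis using True by simp
  next
    case False
    then have "{X. Q X \<and> (\<forall>l\<le>i. X l \<in> A) \<and> X i = y} = {}"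
      using start by blast
    then show ?thesis using False by (simp only: add_0_right measure_empty killed.simps if_False mult_zero_right)
  qed
next
  case (Suc m)
  interpret prob_space "srw E x" by (rule prob_space_srw)
  have Q': "determined_upto (i + m) Q"
    using Q unfolding determined_upto_def by (meson le_add1 le_trans)
  let ?S = "\<lambda>w. {X. Q X \<and> (\<forall>l\<le>i + m. X l \<in> A) \<and> X (i + m) = w \<and> X (Suc (i + m)) = y}"
  have "{X. Q X \<and> (\<forall>l\<le>i + Suc m. X l \<in> A) \<and> X (i + Suc m) = y} = (\<Union>w\<in>A. ?S w)"
    using Suc.prems by (auto simp: le_Suc_eq)
  then have "measure (srw E x) {X. Q X \<and> (\<forall>l\<le>i + Suc m. X l \<in> A) \<and> X (i + Suc m) = y} = (\<Sum>w\<in>A. measure (srw E x) (?S w))"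
  proof (simp only:, intro finite_measure_finite_Union A)
    show "?S ` A \<subseteq> sets (srw E x)"
    proof clarify
      fix w
      have "?S w = {X. Q X \<and> (\<forall>l\<le>i + m. X l \<in> A)} \<inter> {X. X (i + m) = w} \<inter> {X. X (Suc (i + m)) = y}"
        by (intro set_eqI) (simp add: conj_ac)
      also have "\<dots> \<in> sets (srw E x)" using sets_confined[OF A(1) Q'] by (intro sets.Int sets_srw_coord)
      finally show "?S w \<in> sets (srw E x)" .
    qed
  qed (auto simp: disjoint_family_on_def)
  also have "\<dots> = (\<Sum>w\<in>A. measure (srw E x) {X. Q X \<and> (\<forall>l\<le>i. X l \<in> A)} * killed E A m a w * step E w y)"
    by (intro sum.cong refl) (simp only: markov_step[OF A Q'] Suc.IH)
  finally show ?case by (simp add: sum_distrib_left mult.assoc)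
qed

lemma srw_start: "measure (srw E x) {X. X 0 = x} = 1"
proof -
  have "emeasure (srw E x) {X. \<forall>i<1. X i = x} = 1"
    unfolding emeasure_srw_cylinder[where y = "\<lambda>_. x"] by (simp add: srw_step_def emeasure_pmf_single)
  then show ?thesis by (simp add: measure_def)
qed

lemma survival_prob_ge:
  assumes A: "finite A" "A \<subseteq> G" "x \<in> A"
  shows "measure (srw E x) {X. \<forall>l\<le>n. X l \<in> A} \<ge> (\<Sum>y\<in>A. killed E A n x y)"
proof -
  interpret prob_space "srw E x" by (rule prob_space_srw)
  let ?S = "\<lambda>y. {X. X 0 = x \<and> (\<forall>l\<le>n. X l \<in> A) \<and> X n = y}"
  have conf: "{X. \<forall>l\<le>n. X l \<in> A} \<in> sets (srw E x)"
    using sets_confined[of A n "\<lambda>_. True"] A by (simp add: determined_upto_def)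
  have S: "?S y \<in> sets (srw E x)" for y
  proof -
    have "?S y = {X. X 0 = x} \<inter> {X. \<forall>l\<le>n. X l \<in> A} \<inter> {X. X n = y}"
      by (intro set_eqI) (simp add: conj_ac)
    also have "\<dots> \<in> sets (srw E x)" by (intro sets.Int conf sets_srw_coord)
    finally show ?thesis .
  qed
  have "killed E A n x y = measure (srw E x) (?S y)" if "y \<in> A" for y
  proof -
    have "{X. X 0 = x \<and> (\<forall>l\<le>(0::nat). X l \<in> A)} = {X. X 0 = x}" using A(3) by auto
    then show ?thesis
      using markov_property[OF A(1,2), of 0 "\<lambda>X. X 0 = x" x y x n] that by (simp add: srw_start determined_upto_def)
  qed
  then have "(\<Sum>y\<in>A. killed E A n x y) = (\<Sum>y\<in>A. measure (srw E x) (?S y))" by simp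
  also have "\<dots> = measure (srw E x) (\<Union>y\<in>A. ?S y)"
    by (rule finite_measure_finite_Union[symmetric]) (auto simp: A S disjoint_family_on_def)
  also have "\<dots> \<le> measure (srw E x) {X. \<forall>l\<le>n. X l \<in> A}"
    by (rule finite_measure_mono) (auto intro: conf)
  finally show ?thesis .
qed

text \<open>The resistance bound supplies a potential of energy at most \<open>2 * l / R\<close>, to
  which \<open>survival_ge\<close> applies.\<close>

lemma exit_prob_le:
  assumes R: "R > 0" "l > 0" and x: "x \<in> graph_ball G E v R"
    and res: "eff_resistance E {v} (G - graph_ball G E v R) \<ge> ennreal (R / l)"
    and H: "green E (graph_ball G E v R) n x x \<le> H"
  shows "measure (srw E x) {X. \<exists>i\<le>n. X i \<notin> graph_ball G E v R}
    \<le> sqrt (4 * real (graph_dist E v x) * l / R) + sqrt (2 * l * H / R)"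
proof -
  interpret prob_space "srw E x" by (rule prob_space_srw)
  let ?A = "graph_ball G E v R"
  obtain f where f: "f v = 1" "\<And>y. f y \<le> 1" "\<And>y. y \<notin> ?A \<Longrightarrow> f y = 0"
    "dform E (nbhd ?A) f f \<le> 2 * l / R"
    using eff_resistance_potential[OF R res] by metis
  have conf: "{X. \<forall>l\<le>n. X l \<in> ?A} \<in> sets (srw E x)"
    using sets_confined[of ?A n "\<lambda>_. True"] finite_ball by (simp add: determined_upto_def)
  have "1 - sqrt (2 * real (graph_dist E v x) * (2 * l / R)) - sqrt (2 * l / R * green E ?A n x x)
      \<le> (\<Sum>y\<in>?A. killed E ?A n x y)"
    using survival_ge[OF x f(1,2) f(3,4)] .
  also have "\<dots> \<le> measure (srw E x) {X. \<forall>l\<le>n. X l \<in> ?A}"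
    by (rule survival_prob_ge[OF finite_ball ball_subset x])
  finally have 1: "1 - prob {X. \<forall>l\<le>n. X l \<in> ?A}
    \<le> sqrt (2 * real (graph_dist E v x) * (2 * l / R)) + sqrt (2 * l / R * green E ?A n x x)" by simp
  have "{X. \<exists>i\<le>n. X i \<notin> ?A} = space (srw E x) - {X. \<forall>l\<le>n. X l \<in> ?A}" by (auto simp: space_srw)
  then have "prob {X. \<exists>i\<le>n. X i \<notin> ?A} = 1 - prob {X. \<forall>l\<le>n. X l \<in> ?A}"
    using prob_compl[OF conf] by simp
  moreover have "sqrt (2 * l / R * green E ?A n x x) \<le> sqrt (2 * l * H / R)"
    using R H by (simp add: divide_right_mono mult_left_mono)
  moreover have "2 * real (graph_dist E v x) * (2 * l / R) = 4 * real (graph_dist E v x) * l / R" by simp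
  ultimately show ?thesis using 1 by (simp only:)
qed

end

section \<open>Collisions of the walk\<close>

lemma sum_symmetric_le:
  fixes m :: "nat \<Rightarrow> nat \<Rightarrow> real"
  assumes "\<And>i j. m i j = m j i" "\<And>i j. m i j \<ge> 0"
  shows "(\<Sum>i<n. \<Sum>j<n. m i j) \<le> 2 * (\<Sum>i<n. \<Sum>j\<in>{i..<n}. m i j)"
proof -
  let ?u = "\<lambda>i j. if i \<le> j then m i j else 0"
  have "(\<Sum>i<n. \<Sum>j<n. m i j) \<le> (\<Sum>i<n. \<Sum>j<n. ?u i j + ?u j i)"
    using assms by (intro sum_mono) auto
  also have "\<dots> = (\<Sum>i<n. \<Sum>j<n. ?u i j) + (\<Sum>i<n. \<Sum>j<n. ?u j i)"
    by (simp add: sum.distrib)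
  also have "(\<Sum>i<n. \<Sum>j<n. ?u j i) = (\<Sum>i<n. \<Sum>j<n. ?u i j)" by (rule sum.swap)
  also have "(\<Sum>i<n. \<Sum>j<n. ?u i j) = (\<Sum>i<n. \<Sum>j\<in>{i..<n}. m i j)"
    by (rule sum.cong[OF refl], intro sum.mono_neutral_cong_right) auto
  finally show ?thesis by simp
qed

context rooted_graph begin

text \<open>The occupation numbers of the visited vertices add up to \<open>n\<close>.
  Cauchy--Schwarz with the square roots of the degrees as weights separates the volume of the range
  from the sum of squared occupation numbers over degrees, and a squared occupation number counts
  pairs of times.\<close>

lemma square_le_vol_times_collisions:
  assumes "X ` {..<n} \<subseteq> G"
  shows "(real n)\<^sup>2 \<le> vol E (X ` {..<n}) * (\<Sum>i<n. \<Sum>j<n. if X i = X j then 1 / real (vdeg E (X i)) else 0)"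
proof -
  let ?W = "X ` {..<n}"
  let ?N = "\<lambda>z. (\<Sum>i<n. if X i = z then 1 else 0 :: real)"
  let ?m = "\<lambda>z. sqrt (real (vdeg E z))"
  have m: "?m z > 0" if "z \<in> ?W" for z using vdeg_pos[of z] assms that by (auto simp: subset_iff)
  have "(\<Sum>z\<in>?W. ?N z) = (\<Sum>i<n. \<Sum>z\<in>?W. if X i = z then 1 else 0)" by (rule sum.swap)
  also have "\<dots> = (\<Sum>i<n. 1)" by (intro sum.cong refl) (simp add: sum.delta)
  finally have "real n = (\<Sum>z\<in>?W. ?m z * (?N z / ?m z))"
    using m by (simp add: less_imp_neq[symmetric] cong: sum.cong)
  then have "(real n)\<^sup>2 \<le> (\<Sum>z\<in>?W. (?m z)\<^sup>2) * (\<Sum>z\<in>?W. (?N z / ?m z)\<^sup>2)"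
    by (simp only: Cauchy_Schwarz_ineq_sum)
  also have "(\<Sum>z\<in>?W. (?m z)\<^sup>2) = vol E ?W" by (simp add: vol_def)
  also have "(\<Sum>z\<in>?W. (?N z / ?m z)\<^sup>2)
      = (\<Sum>z\<in>?W. \<Sum>i<n. \<Sum>j<n. (if X i = z then 1 else 0) * (if X j = z then 1 else 0) / real (vdeg E z))"
  proof (rule sum.cong[OF refl])
    fix z
    have "(?N z / ?m z)\<^sup>2 = ?N z * ?N z / real (vdeg E z)"
      by (simp only: power_divide power2_eq_square[of "?N z"] real_sqrt_pow2 of_nat_0_le_iff)
    then show "(?N z / ?m z)\<^sup>2
        = (\<Sum>i<n. \<Sum>j<n. (if X i = z then 1 else 0) * (if X j = z then 1 else 0) / real (vdeg E z))"
      by (simp only: sum_product sum_divide_distrib)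
  qed
  also have "\<dots> = (\<Sum>i<n. \<Sum>j<n. \<Sum>z\<in>?W. (if X i = z then 1 else 0) * (if X j = z then 1 else 0) / real (vdeg E z))"
    by (subst sum.swap) (intro sum.cong refl sum.swap)
  also have "\<dots> = (\<Sum>i<n. \<Sum>j<n. if X i = X j then 1 / real (vdeg E (X i)) else 0)"
  proof (intro sum.cong refl)
    fix i j assume "i \<in> {..<n}" "j \<in> {..<n}"
    have "(\<Sum>z\<in>?W. (if X i = z then 1 else 0) * (if X j = z then 1 else 0) / real (vdeg E z))
      = (\<Sum>z\<in>?W. if X i = z then (if X i = X j then 1 / real (vdeg E (X i)) else 0) else 0)"
      by (intro sum.cong refl) auto
    also have "\<dots> = (if X i = X j then 1 / real (vdeg E (X i)) else 0)"
      using \<open>i \<in> {..<n}\<close> by (subst sum.delta') simp_all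
    finally show "(\<Sum>z\<in>?W. (if X i = z then 1 else 0) * (if X j = z then 1 else 0) / real (vdeg E z))
      = (if X i = X j then 1 / real (vdeg E (X i)) else 0)" .
  qed
  finally show ?thesis .
qed

lemma collision_prob:
  assumes A: "finite A" "A \<subseteq> G" "z \<in> A" and ij: "i \<le> j"
  shows "measure (srw E x) {X. X i = z \<and> X j = z \<and> (\<forall>l\<le>j. X l \<in> A)}
    = measure (srw E x) {X. X i = z \<and> (\<forall>l\<le>i. X l \<in> A)} * killed E A (j - i) z z"
proof -
  have "determined_upto i (\<lambda>X. X i = z)" by (simp add: determined_upto_def)
  from markov_property[OF A(1,2) this, of z z x "j - i"] ij A(3) show ?thesis
    by (simp add: conj_ac)
qed

lemma sets_collision:
  assumes "finite A"
  shows "{X. X i = z \<and> X j = z \<and> (\<forall>l\<le>n. X l \<in> A)} \<in> sets (srw E x)"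
proof -
  have "{X. X i = z \<and> X j = z \<and> (\<forall>l\<le>n. X l \<in> A)} = {X. X i = z} \<inter> {X. X j = z} \<inter> {X. True \<and> (\<forall>l\<le>n. X l \<in> A)}"
    by auto
  also have "\<dots> \<in> sets (srw E x)"
    using assms by (intro sets.Int sets_srw_coord sets_confined) (simp_all add: determined_upto_def)
  finally show ?thesis .
qed

text \<open>For a fixed first time \<open>i\<close>, the Markov property turns the sum over later
  times into a diagonal Green function, bounded by \<open>H\<close>; the probabilities of the
  possible positions at time \<open>i\<close> add up to at most 1. Restricting to
  \<open>i \<le> j\<close> costs the factor 2.\<close>

lemma expected_collisions_le:
  assumes A: "finite A" "A \<subseteq> G" and H: "\<And>z. z \<in> A \<Longrightarrow> green E A n z z \<le> H" and H0: "H \<ge> 0"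
  shows "(\<Sum>i<n. \<Sum>j<n. \<Sum>z\<in>A. measure (srw E x) {X. X i = z \<and> X j = z \<and> (\<forall>l\<le>n. X l \<in> A)} / real (vdeg E z))
    \<le> 2 * real n * H"
proof -
  interpret prob_space "srw E x" by (rule prob_space_srw)
  define m where "m i j = (\<Sum>z\<in>A. prob {X. X i = z \<and> X j = z \<and> (\<forall>l\<le>n. X l \<in> A)} / real (vdeg E z))" for i j
  let ?a = "\<lambda>i z. prob {X. X i = z \<and> (\<forall>l\<le>i. X l \<in> A)}"
  have sa: "(\<Sum>z\<in>A. ?a i z) \<le> 1" for i
  proof -
    have S: "{X. X i = z \<and> (\<forall>l\<le>i. X l \<in> A)} \<in> events" for z
      using sets_collision[OF A(1), of i z i i] by simp
    have "(\<Sum>z\<in>A. ?a i z) = prob (\<Union>z\<in>A. {X. X i = z \<and> (\<forall>l\<le>i. X l \<in> A)})"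
      using S by (intro finite_measure_finite_Union[symmetric]) (auto simp: A disjoint_family_on_def)
    then show ?thesis by simp
  qed
  have green: "(\<Sum>j\<in>{i..<n}. killed E A (j - i) z z) / real (vdeg E z) \<le> H" if z: "z \<in> A" for i z
  proof -
    have "(\<Sum>j\<in>{i..<n}. killed E A (j - i) z z) = (\<Sum>k<n - i. killed E A k z z)"
      by (rule sum.reindex_bij_witness[of _ "\<lambda>k. k + i" "\<lambda>j. j - i"]) auto
    also have "\<dots> \<le> (\<Sum>k<n. killed E A k z z)" by (intro sum_mono2) (auto simp: killed_nonneg)
    finally have "(\<Sum>j\<in>{i..<n}. killed E A (j - i) z z) / real (vdeg E z) \<le> green E A n z z"
      using z by (simp add: green_def divide_right_mono)
    with H[OF z] show ?thesis by simp
  qed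
  have row: "(\<Sum>j\<in>{i..<n}. m i j) \<le> H" for i
  proof -
    have "(\<Sum>j\<in>{i..<n}. m i j) \<le> (\<Sum>j\<in>{i..<n}. \<Sum>z\<in>A. ?a i z * (killed E A (j - i) z z / real (vdeg E z)))"
      unfolding m_def
    proof (intro sum_mono)
      fix j z assume j: "j \<in> {i..<n}" and z: "z \<in> A"
      \<comment> \<open>Confinement is weakened from time \<open>n\<close> to time \<open>j\<close>,
        the form in which the Markov property applies.\<close>
      have "prob {X. X i = z \<and> X j = z \<and> (\<forall>l\<le>n. X l \<in> A)} \<le> prob {X. X i = z \<and> X j = z \<and> (\<forall>l\<le>j. X l \<in> A)}"
        using j sets_collision[OF A(1)] by (intro finite_measure_mono) auto
      also have "\<dots> = ?a i z * killed E A (j - i) z z"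
        using j z by (intro collision_prob A) auto
      finally show "prob {X. X i = z \<and> X j = z \<and> (\<forall>l\<le>n. X l \<in> A)} / real (vdeg E z)
          \<le> ?a i z * (killed E A (j - i) z z / real (vdeg E z))"
        by (simp add: divide_right_mono)
    qed
    also have "\<dots> = (\<Sum>z\<in>A. \<Sum>j\<in>{i..<n}. ?a i z * (killed E A (j - i) z z / real (vdeg E z)))"
      by (rule sum.swap)
    also have "\<dots> = (\<Sum>z\<in>A. ?a i z * ((\<Sum>j\<in>{i..<n}. killed E A (j - i) z z) / real (vdeg E z)))"
      by (simp add: sum_distrib_left sum_divide_distrib)
    also have "\<dots> \<le> (\<Sum>z\<in>A. ?a i z * H)"
      by (intro sum_mono mult_left_mono green) auto
    also have "\<dots> \<le> 1 * H"
      unfolding sum_distrib_right[symmetric] by (intro mult_right_mono sa H0)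
    finally show ?thesis by simp
  qed
  have "(\<Sum>i<n. \<Sum>j<n. m i j) \<le> 2 * (\<Sum>i<n. \<Sum>j\<in>{i..<n}. m i j)"
    by (rule sum_symmetric_le) (auto simp: m_def conj_ac intro!: sum_nonneg)
  also have "\<dots> \<le> 2 * (\<Sum>i<n. H)" by (intro mult_left_mono sum_mono row) auto
  finally show ?thesis by (simp add: m_def)
qed

text \<open>By the Cauchy--Schwarz bound, a confined walk with range volume at most
  \<open>n\<^sup>2 / c\<close> has collision number at least \<open>c\<close>, which Markov's
  inequality makes unlikely.\<close>

lemma small_range_prob_le:
  assumes A: "finite A" "A \<subseteq> G" and H: "\<And>z. z \<in> A \<Longrightarrow> green E A n z z \<le> H" and H0: "H \<ge> 0" and c: "c > 0" and n: "n > 0"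
  shows "measure (srw E x) {X. vol E (X ` {0..n}) \<le> (real n)\<^sup>2 / c \<and> (\<forall>l\<le>n. X l \<in> A)} \<le> 2 * real n * H / c"
proof -
  interpret prob_space "srw E x" by (rule prob_space_srw)
  let ?S = "\<lambda>i j z. {X. X i = z \<and> X j = z \<and> (\<forall>l\<le>n. X l \<in> A)}"
  \<comment> \<open>On confined paths this is the weighted collision number, elsewhere it is 0. As a
    finite combination of indicators it is integrable.\<close>
  define U where "U X = (\<Sum>i<n. \<Sum>j<n. \<Sum>z\<in>A. indicator (?S i j z) X / real (vdeg E z))" for X
  have S: "?S i j z \<in> events" for i j z by (rule sets_collision[OF A(1)])
  have U_int: "integrable (srw E x) U" unfolding U_def
    by (intro Bochner_Integration.integrable_sum integrable_divide integrable_real_indicator)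
       (use S emeasure_finite in \<open>auto simp: less_top[symmetric]\<close>)
  have int: "integrable (srw E x) (\<lambda>X. indicator (?S i j z) X / real (vdeg E z))" for i j z
    by (intro integrable_divide integrable_real_indicator)
       (use S emeasure_finite in \<open>auto simp: less_top[symmetric]\<close>)
  have "(\<integral>X. U X \<partial>srw E x) = (\<Sum>i<n. \<Sum>j<n. \<Sum>z\<in>A. prob (?S i j z) / real (vdeg E z))"
    unfolding U_def using S int by simp
  also have "\<dots> \<le> 2 * real n * H" by (rule expected_collisions_le[OF A H H0])
  finally have EU: "(\<integral>X. U X \<partial>srw E x) \<le> 2 * real n * H" .
  have "{X. vol E (X ` {0..n}) \<le> (real n)\<^sup>2 / c \<and> (\<forall>l\<le>n. X l \<in> A)} \<subseteq> {X \<in> space (srw E x). U X \<ge> c}"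
  proof clarify
    fix X assume X: "vol E (X ` {0..n}) \<le> (real n)\<^sup>2 / c" "\<forall>l\<le>n. X l \<in> A"
    have "U X = (\<Sum>i<n. \<Sum>j<n. \<Sum>z\<in>A. if X i = z then (if X i = X j then 1 / real (vdeg E (X i)) else 0) else 0)"
      unfolding U_def using X(2) by (intro sum.cong refl) (auto simp: indicator_def)
    also have "\<dots> = (\<Sum>i<n. \<Sum>j<n. if X i = X j then 1 / real (vdeg E (X i)) else 0)"
      using X(2) A(1) by (intro sum.cong refl) (subst sum.delta', auto)
    finally have U: "U X = (\<Sum>i<n. \<Sum>j<n. if X i = X j then 1 / real (vdeg E (X i)) else 0)" .
    have "X ` {..<n} \<subseteq> G" using X(2) A(2) by auto
    from square_le_vol_times_collisions[OF this]
    have "(real n)\<^sup>2 \<le> vol E (X ` {..<n}) * U X" unfolding U .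
    also have "\<dots> \<le> ((real n)\<^sup>2 / c) * U X"
    proof (rule mult_right_mono)
      have "vol E (X ` {..<n}) \<le> vol E (X ` {0..n})"
        unfolding vol_def by (intro sum_mono2) auto
      then show "vol E (X ` {..<n}) \<le> (real n)\<^sup>2 / c" using X(1) by simp
      show "0 \<le> U X" unfolding U by (intro sum_nonneg) auto
    qed
    finally have "(real n)\<^sup>2 * c \<le> (real n)\<^sup>2 * U X" using c by (simp add: field_simps)
    then have "c \<le> U X" using n by simp
    then show "X \<in> space (srw E x) \<and> c \<le> U X" by (simp add: space_srw)
  qed
  then have "prob {X. vol E (X ` {0..n}) \<le> (real n)\<^sup>2 / c \<and> (\<forall>l\<le>n. X l \<in> A)} \<le> prob {X \<in> space (srw E x). U X \<ge> c}"
    using borel_measurable_integrable[OF U_int] by (intro finite_measure_mono) measurable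
  also have "\<dots> \<le> (\<integral>X. U X \<partial>srw E x) / c"
  proof (rule integral_Markov_inequality_measure[OF U_int sets.top _ c])
    show "AE X in srw E x. 0 \<le> U X" unfolding U_def by (intro AE_I2 sum_nonneg) simp
  qed
  also have "\<dots> \<le> 2 * real n * H / c" using EU c by (simp add: divide_right_mono)
  finally show ?thesis .
qed

end

section \<open>Estimates along geometric scales\<close>

context rooted_graph begin

text \<open>The constant of goodness is \<open>q\<close> itself and all scales are powers of
  \<open>q\<close>. Every loss is therefore a bounded power of \<open>q\<close>, up to numerical
  factors, and is negligible in the exponent once \<open>N\<close> is large. The small-range part of
  \<open>bad\<close> includes confinement, which makes it measurable by
  \<open>sets_confined\<close>.\<close>

lemma scale_prob:
  fixes q :: real and N k :: nat
  defines "q \<equiv> 2 ^ k" and "n \<equiv> 2 ^ (3 * N * k)"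
  assumes k: "k \<ge> 1" and x: "x \<in> G" "real (graph_dist E v x) \<le> q ^ N"
    and good: "q ^ N \<in> good_scales G E v q" "q ^ (N + 4) \<in> good_scales G E v q"
  defines "A \<equiv> graph_ball G E v (q ^ (N + 4))"
  defines "bad \<equiv> {X. \<exists>i\<le>n. X i \<notin> A} \<union> {X. vol E (X ` {0..n}) \<le> q ^ (3 * N) / (20 * q ^ (N + 5)) \<and> (\<forall>i\<le>n. X i \<in> A)}"
  shows "bad \<in> sets (srw E x)"
    and "measure (srw E x) bad \<le> (6 + 2 * sqrt (real (graph_dist E v x))) / q"
    and "X \<notin> bad \<Longrightarrow> X ` {0..n} \<subseteq> G \<and> q ^ (3 * N) / (20 * q ^ (N + 5)) \<le> vol E (X ` {0..n})
      \<and> vol E (X ` {0..n}) \<le> q ^ (2 * N + 9)"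
proof -
  interpret prob_space "srw E x" by (rule prob_space_srw)
  let ?r = "q ^ N" and ?R = "q ^ (N + 4)" and ?d = "real (graph_dist E v x)"
  have q: "q \<ge> 1" "q > 0" by (auto simp: q_def)
  have q1: "q > 1" using k by (simp add: q_def one_less_power)
  have rR: "?r < ?R" using q1 by (intro power_strict_increasing) auto
  have r0: "?r > 0" using q by simp
  have n: "real n = q ^ (3 * N)" by (simp add: n_def q_def mult_ac flip: power_mult)
  have A: "finite A" "A \<subseteq> G" using finite_ball ball_subset by (auto simp: A_def)
  have xA: "x \<in> A" using x rR by (simp add: A_def graph_ball_def)
  let ?V = "\<lambda>s. vol E (graph_ball G E v s)"
  have V: "?r\<^sup>2 / q \<le> ?V ?r" "?R\<^sup>2 / q \<le> ?V ?R" "?V ?R \<le> q * ?R\<^sup>2"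
    and res: "ennreal (?R / q) \<le> eff_resistance E {v} (G - A)"
    using good by (auto simp: good_scales_def A_def)
  \<comment> \<open>As \<open>x\<close> lies within \<open>q ^ N\<close> of the root, the small ball
    can be used; its lower volume bound gives n / V(r) \<le> q ^ (N + 1).\<close>
  have gx: "green E A n x x \<le> 10 * q ^ (N + 1)"
  proof -
    have "green E A n x x \<le> 2 * real n / ?V ?r + 8 * ?r"
      unfolding A_def using xA x rR r0 by (intro green_diag_le) (auto simp: A_def)
    also have "2 * real n / ?V ?r \<le> 2 * real n / (?r\<^sup>2 / q)"
      using V(1) r0 q by (intro divide_left_mono mult_pos_pos) (auto intro: less_le_trans[OF _ V(1)])
    also have "\<dots> = 2 * q ^ (N + 1)"
    proof -
      have "real n = ?r * ?r\<^sup>2"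
        by (simp only: n power_mult mult.commute[of 3] power3_eq_cube power2_eq_square mult_ac)
      then show ?thesis using q by simp
    qed
    also have "8 * ?r \<le> 8 * q ^ (N + 1)" using q by (intro mult_left_mono power_increasing) auto
    finally show ?thesis by simp
  qed
  \<comment> \<open>Here \<open>z\<close> may be anywhere in \<open>A\<close>, so all radii are
    \<open>q ^ (N + 4)\<close> and the bound is only of that order.\<close>
  have gz: "green E A n z z \<le> 10 * ?R" if "z \<in> A" for z
  proof -
    have "green E A n z z \<le> 2 * real n / ?V ?R + 8 * ?R"
      unfolding A_def using that r0 rR by (intro green_diag_le) (auto simp: A_def graph_ball_def)
    also have "2 * real n / ?V ?R \<le> 2 * real n / (?R\<^sup>2 / q)"
      using V(2) q by (intro divide_left_mono mult_pos_pos) (auto intro: less_le_trans[OF _ V(2)])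
    also have "\<dots> = 2 * (q ^ (3 * N + 1) / ?R\<^sup>2)" by (simp add: n mult_ac)
    also have "q ^ (3 * N + 1) / ?R\<^sup>2 \<le> ?R"
    proof -
      have "q ^ (3 * N + 1) \<le> q ^ ((N + 4) + (N + 4) + (N + 4))"
        using q by (intro power_increasing) auto
      also have "\<dots> = ?R * ?R\<^sup>2" by (simp only: power_add power2_eq_square mult_ac)
      finally show ?thesis using q by (simp add: divide_le_eq)
    qed
    finally show ?thesis by simp
  qed
  have exit_sets: "{X. \<exists>i\<le>n. X i \<notin> A} \<in> events"
  proof -
    have "{X. True \<and> (\<forall>i\<le>n. X i \<in> A)} \<in> events"
      by (rule sets_confined[OF A(1)]) (simp add: determined_upto_def)
    then have "space (srw E x) - {X. True \<and> (\<forall>i\<le>n. X i \<in> A)} \<in> events" by blast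
    also have "space (srw E x) - {X. True \<and> (\<forall>i\<le>n. X i \<in> A)} = {X. \<exists>i\<le>n. X i \<notin> A}"
      by (auto simp: space_srw)
    finally show ?thesis .
  qed
  let ?S = "{X. vol E (X ` {0..n}) \<le> q ^ (3 * N) / (20 * q ^ (N + 5)) \<and> (\<forall>i\<le>n. X i \<in> A)}"
  have small_sets: "?S \<in> events"
  proof (rule sets_confined[OF A(1)])
    have "X ` {0..n} = Y ` {0..n}" if "\<forall>l\<le>n. X l = Y l" for X Y :: "nat \<Rightarrow> 'v"
      using that by (intro image_cong) auto
    then show "determined_upto n (\<lambda>X. vol E (X ` {0..n}) \<le> q ^ (3 * N) / (20 * q ^ (N + 5)))"
      unfolding determined_upto_def by metis
  qed
  show "bad \<in> events" unfolding bad_def by (intro sets.Un exit_sets small_sets)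
  have "prob {X. \<exists>i\<le>n. X i \<notin> A} \<le> sqrt (4 * ?d * q / ?R) + sqrt (2 * q * (10 * q ^ (N + 1)) / ?R)"
    unfolding A_def using q xA res gx by (intro exit_prob_le) (auto simp: A_def)
  also have "sqrt (4 * ?d * q / ?R) \<le> 2 * sqrt ?d / q"
  proof -
    have "q * q\<^sup>2 \<le> ?R" using power_increasing[of 3 "N + 4" q] q by (simp add: power3_eq_cube power2_eq_square)
    then have "4 * ?d * q / ?R \<le> 4 * ?d * q / (q * q\<^sup>2)" using q by (intro divide_left_mono) auto
    also have "\<dots> = (2 * sqrt ?d / q)\<^sup>2" using q by (simp add: power_divide power_mult_distrib)
    finally show ?thesis using q by (intro real_le_lsqrt) auto
  qed
  \<comment> \<open>This fixes the exponent 4 in the outer radius: the powers of \<open>q\<close>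
    under the root combine to \<open>1 / q\<^sup>2\<close>, which leaves a bound summable in
    \<open>k\<close>.\<close>
  also have "sqrt (2 * q * (10 * q ^ (N + 1)) / ?R) \<le> 5 / q"
  proof -
    have "2 * q * (10 * q ^ (N + 1)) / ?R = 20 / q\<^sup>2"
      using q by (simp add: power_add field_simps power2_eq_square eval_nat_numeral)
    also have "\<dots> \<le> (5 / q)\<^sup>2" by (simp add: power_divide divide_right_mono)
    finally show ?thesis using q by (intro real_le_lsqrt) auto
  qed
  finally have exit: "prob {X. \<exists>i\<le>n. X i \<notin> A} \<le> 2 * sqrt ?d / q + 5 / q" by simp
  \<comment> \<open>The threshold is \<open>q\<close> times the bound on the expected collision
    number, so that Markov's inequality gives \<open>1 / q\<close>.\<close>
  have c: "20 * real n * ?R * q > 0" using q n by simp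
  have "(real n)\<^sup>2 / (20 * real n * ?R * q) = q ^ (3 * N) / (20 * q ^ (N + 5))"
    using q by (simp add: n power2_eq_square power_add eval_nat_numeral)
  then have "prob ?S \<le> 2 * real n * (10 * ?R) / (20 * real n * ?R * q)"
    using small_range_prob_le[OF A gz _ c, of x] q by (simp add: n_def)
  also have "\<dots> = 1 / q" using q by (simp add: n)
  finally have small: "prob ?S \<le> 1 / q" .
  have "prob bad \<le> prob {X. \<exists>i\<le>n. X i \<notin> A} + prob ?S"
    unfolding bad_def by (rule measure_Un_le[OF exit_sets small_sets])
  also have "\<dots> \<le> (2 * sqrt ?d / q + 5 / q) + 1 / q" using exit small by (rule add_mono)
  also have "\<dots> = (6 + 2 * sqrt ?d) / q" by (simp add: add_divide_distrib)
  finally show "prob bad \<le> (6 + 2 * sqrt ?d) / q" .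
  assume X: "X \<notin> bad"
  then have XA: "X ` {0..n} \<subseteq> A" by (auto simp: bad_def)
  have "vol E (X ` {0..n}) \<le> vol E A" unfolding vol_def using XA A by (intro sum_mono2) auto
  also have "\<dots> \<le> q * ?R\<^sup>2" using V(3) by (simp add: A_def)
  also have "\<dots> = q ^ (2 * N + 9)" by (simp add: power_add power_mult power2_eq_square eval_nat_numeral mult_ac power_mult_distrib)
  finally have "vol E (X ` {0..n}) \<le> q ^ (2 * N + 9)" .
  moreover have "q ^ (3 * N) / (20 * q ^ (N + 5)) \<le> vol E (X ` {0..n})"
    using X XA by (fastforce simp: bad_def)
  ultimately show "X ` {0..n} \<subseteq> G \<and> q ^ (3 * N) / (20 * q ^ (N + 5)) \<le> vol E (X ` {0..n})
      \<and> vol E (X ` {0..n}) \<le> q ^ (2 * N + 9)" using XA A by blast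
qed

text \<open>The failure probabilities decay like \<open>1 / 2 ^ k\<close>, with a factor depending
  on \<open>x\<close> only, so the Borel--Cantelli lemma applies.\<close>

lemma AE_dyadic_bounds:
  assumes x: "x \<in> G" and N: "N \<ge> 1"
    and good: "\<And>m. m \<ge> 1 \<Longrightarrow> \<forall>\<^sub>F k in sequentially. (2 ^ k) ^ m \<in> good_scales G E v (2 ^ k)"
  shows "AE X in srw E x. \<forall>\<^sub>F k in sequentially. X ` {0..2 ^ (3 * N * k)} \<subseteq> G
    \<and> (2 ^ k) ^ (3 * N) / (20 * (2 ^ k) ^ (N + 5)) \<le> vol E (X ` {0..2 ^ (3 * N * k)})
    \<and> vol E (X ` {0..2 ^ (3 * N * k)}) \<le> (2 ^ k) ^ (2 * N + 9)"
proof -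
  interpret prob_space "srw E x" by (rule prob_space_srw)
  let ?d = "real (graph_dist E v x)"
  let ?ok = "\<lambda>X k. X ` {0..2 ^ (3 * N * k)} \<subseteq> G
    \<and> (2 ^ k) ^ (3 * N) / (20 * (2 ^ k) ^ (N + 5)) \<le> vol E (X ` {0..2 ^ (3 * N * k)})
    \<and> vol E (X ` {0..2 ^ (3 * N * k)}) \<le> (2 ^ k) ^ (2 * N + 9)"
  have large: "\<forall>\<^sub>F k in sequentially. ?d \<le> (2 ^ k) ^ N"
  proof (rule eventually_sequentiallyI)
    fix k assume "graph_dist E v x \<le> k"
    then have "?d \<le> real k" by simp
    also have "\<dots> \<le> 2 ^ k" using of_nat_less_two_power[of k, where 'a = real] by simp
    also have "\<dots> \<le> (2 ^ k) ^ N" using N self_le_power[of "2 ^ k :: real" N] by simp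
    finally show "?d \<le> (2 ^ k) ^ N" .
  qed
  have "\<forall>\<^sub>F k in sequentially. k \<ge> 1 \<and> ?d \<le> (2 ^ k) ^ N
      \<and> (2 ^ k) ^ N \<in> good_scales G E v (2 ^ k) \<and> (2 ^ k) ^ (N + 4) \<in> good_scales G E v (2 ^ k)"
    using N by (intro eventually_conj eventually_ge_at_top large good) auto
  then obtain K where K: "\<And>k. k \<ge> K \<Longrightarrow> k \<ge> 1 \<and> ?d \<le> (2 ^ k) ^ N
      \<and> (2 ^ k) ^ N \<in> good_scales G E v (2 ^ k) \<and> (2 ^ k) ^ (N + 4) \<in> good_scales G E v (2 ^ k)"
    unfolding eventually_sequentially by blast
  \<comment> \<open>Early \<open>k\<close> receive the empty event, so that the probability bound
    holds for every \<open>k\<close>.\<close>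
  have "\<exists>B\<in>events. prob B \<le> (6 + 2 * sqrt ?d) / 2 ^ k \<and> (k \<ge> K \<longrightarrow> (\<forall>X. X \<notin> B \<longrightarrow> ?ok X k))" for k
  proof (cases "k \<ge> K")
    case True
    with K have k: "k \<ge> 1" "?d \<le> (2 ^ k) ^ N" "(2 ^ k) ^ N \<in> good_scales G E v (2 ^ k)"
      "(2 ^ k) ^ (N + 4) \<in> good_scales G E v (2 ^ k)" by blast+
    note s = scale_prob[OF k(1) x k(2-4)]
    show ?thesis by (rule bexI[OF _ s(1)]) (use s(2,3) in blast)
  next
    case False
    then show ?thesis by (intro bexI[of _ "{}"]) auto
  qed
  then obtain B where B: "\<And>k. B k \<in> events" "\<And>k. prob (B k) \<le> (6 + 2 * sqrt ?d) / 2 ^ k"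
    "\<And>k X. k \<ge> K \<Longrightarrow> X \<notin> B k \<Longrightarrow> ?ok X k" by metis
  have "summable (\<lambda>k. (6 + 2 * sqrt ?d) * (1 / 2) ^ k)" by (intro summable_mult summable_geometric) simp
  then have "summable (\<lambda>k. prob (B k))"
    by (rule summable_comparison_test') (use B(2) in \<open>simp add: power_divide\<close>)
  then have "AE X in srw E x. \<forall>\<^sub>F k in sequentially. X \<in> space (srw E x) - B k"
    using B(1) by (intro borel_cantelli_AE1) (auto simp: emeasure_finite less_top[symmetric])
  then show ?thesis
  proof eventually_elim
    case (elim X)
    with eventually_ge_at_top[of K] show ?case
      by eventually_elim (use B(3) in blast)
  qed
qed

end

section \<open>Interpolation between geometric times\<close>

lemma dyadic_bracket:
  fixes n M k0 :: nat
  assumes "M \<ge> 1" "n \<ge> 2 ^ (M * k0)"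
  obtains k where "k \<ge> k0" "2 ^ (M * k) \<le> n" "n \<le> 2 ^ (M * Suc k)"
proof -
  define t where "t = (LEAST t. n < 2 ^ (M * t))"
  have "n < 2 ^ n" by (rule less_exp)
  also have "\<dots> \<le> 2 ^ (M * n)" using assms(1) by (intro power_increasing) auto
  finally have t: "n < 2 ^ (M * t)" unfolding t_def by (rule LeastI)
  have min: "2 ^ (M * s) \<le> n" if "s < t" for s
    using not_less_Least[of s "\<lambda>t. n < 2 ^ (M * t)"] that by (simp add: t_def)
  have "(2::nat) ^ (M * k0) < 2 ^ (M * t)" using assms(2) t by linarith
  then have "k0 < t" using assms(1) by (simp add: power_strict_increasing_iff)
  then obtain k where "t = Suc k" "k \<ge> k0" by (metis Suc_le_D Suc_le_mono Suc_leI)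
  with that[of k] min[of k] t show thesis by simp
qed

text \<open>Bracket \<open>n\<close> between consecutive times \<open>2 ^ (3 * N * k)\<close>. For
  the base-2 logarithms \<open>t\<close> of \<open>n\<close> and \<open>s\<close> of
  \<open>S n\<close>, monotonicity gives t = 3Nk + O(N) and s = 2Nk + O(N + k). Once
  \<open>k \<ge> N\<close>, the ratio \<open>s / t\<close> is within \<open>7 / N\<close> of
  \<open>2 / 3\<close>.\<close>

lemma log_ratio_limit:
  fixes S :: "nat \<Rightarrow> real"
  assumes S: "mono S"
    and bounds: "\<And>N. N \<ge> 1 \<Longrightarrow> \<forall>\<^sub>F k in sequentially.
      (2 ^ k) ^ (3 * N) / (20 * (2 ^ k) ^ (N + 5)) \<le> S (2 ^ (3 * N * k)) \<and> S (2 ^ (3 * N * k)) \<le> (2 ^ k) ^ (2 * N + 9)"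
  shows "(\<lambda>n. ln (S n) / ln (real n)) \<longlonglongrightarrow> 2 / 3"
proof (rule LIMSEQ_I)
  fix \<epsilon> :: real assume "\<epsilon> > 0"
  obtain N0 :: nat where "7 / \<epsilon> < real N0" using reals_Archimedean2 by blast
  define N where "N = max 5 N0"
  have N: "N \<ge> 5" "7 / \<epsilon> < real N" using \<open>7 / \<epsilon> < real N0\<close> by (auto simp: N_def)
  have eps: "7 / real N < \<epsilon>" using N \<open>\<epsilon> > 0\<close> by (simp add: field_simps)
  from bounds[of N] N obtain K where K:
    "\<And>k. k \<ge> K \<Longrightarrow> (2 ^ k) ^ (3 * N) / (20 * (2 ^ k) ^ (N + 5)) \<le> S (2 ^ (3 * N * k))
      \<and> S (2 ^ (3 * N * k)) \<le> (2 ^ k) ^ (2 * N + 9)"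
    unfolding eventually_sequentially by auto
  show "\<exists>n0. \<forall>n\<ge>n0. norm (ln (S n) / ln (real n) - 2 / 3) < \<epsilon>"
  proof (intro exI allI impI)
    fix n :: nat assume n: "n \<ge> 2 ^ (3 * N * max K N)"
    obtain k where k: "k \<ge> max K N" "2 ^ (3 * N * k) \<le> n" "n \<le> 2 ^ (3 * N * Suc k)"
      using dyadic_bracket[OF _ n] N by auto
    have kN: "real k \<ge> real N" "real N \<ge> 5" using k N by auto
    have n_pos: "real n > 0" using k(2) by (meson le_trans less_le_trans of_nat_0_less_iff pos2 zero_less_power)
    define t where "t = ln (real n) / ln 2"
    have t: "3 * real N * real k \<le> t" "t \<le> 3 * real N * (real k + 1)"
    proof -
      have "ln (real (2 ^ (3 * N * k))) \<le> ln (real n)" using k(2) n_pos by (subst ln_le_cancel_iff) auto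
      then show "3 * real N * real k \<le> t" by (simp add: t_def ln_realpow field_simps)
      have "real n \<le> real (2 ^ (3 * N * Suc k))" using k(3) by (simp only: of_nat_le_iff)
      from this n_pos have "ln (real n) \<le> ln (real (2 ^ (3 * N * Suc k)))" by (rule ln_mono)
      then show "t \<le> 3 * real N * (real k + 1)" by (simp add: t_def ln_realpow field_simps)
    qed
    define s where "s = ln (S n) / ln 2"
    have lower: "(2 ^ k) ^ (3 * N) / (20 * (2 ^ k) ^ (N + 5)) \<le> S n"
      using K[of k] k monoD[OF S k(2)] by auto
    moreover have "0 < (2 ^ k :: real) ^ (3 * N) / (20 * (2 ^ k) ^ (N + 5))" by simp
    ultimately have Sn: "S n > 0" by linarith
    have upper: "S n \<le> (2 ^ Suc k) ^ (2 * N + 9)"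
      using K[of "Suc k"] k monoD[OF S k(3)] by auto
    have s: "2 * real N * real k - 5 * (real k + 1) \<le> s" "s \<le> (2 * real N + 9) * (real k + 1)"
    proof -
      \<comment> \<open>Replacing 20 by the next power of 2 makes the base-2 logarithm of the bound
        an integer.\<close>
      have "(2 ^ k :: real) ^ (3 * N) / (2 ^ 5 * (2 ^ k) ^ (N + 5)) \<le> (2 ^ k) ^ (3 * N) / (20 * (2 ^ k) ^ (N + 5))"
        by (intro divide_left_mono mult_right_mono) auto
      with lower have "(2 ^ k :: real) ^ (3 * N) / (2 ^ 5 * (2 ^ k) ^ (N + 5)) \<le> S n" by linarith
      then have "ln ((2 ^ k :: real) ^ (3 * N) / (2 ^ 5 * (2 ^ k) ^ (N + 5))) \<le> ln (S n)"
        using Sn by (subst ln_le_cancel_iff) auto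
      then have "real (3 * N) * (real k * ln 2) - (5 * ln 2 + real (N + 5) * (real k * ln 2)) \<le> ln (S n)"
        using ln_realpow[of "2::real" 5] by (simp add: ln_div ln_mult ln_realpow)
      then have "(2 * real N * real k - 5 * (real k + 1)) * ln 2 \<le> ln (S n)" by (simp add: algebra_simps)
      then show "2 * real N * real k - 5 * (real k + 1) \<le> s" by (simp add: s_def pos_le_divide_eq)
      have "ln (S n) \<le> ln ((2 ^ Suc k) ^ (2 * N + 9))"
        using Sn upper by (subst ln_le_cancel_iff) auto
      also have "\<dots> = (2 * real N + 9) * (real k + 1) * ln 2"
        by (simp only: ln_realpow zero_less_power zero_less_numeral) simp
      finally show "s \<le> (2 * real N + 9) * (real k + 1)" by (simp add: s_def pos_divide_le_eq)
    qed
    have t0: "t > 0" using t(1) kN by (intro less_le_trans[OF _ t(1)]) auto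
    have "s / t \<le> 2 / 3 + 7 / real N"
    proof -
      have "s \<le> (2 * real N + 9) * (real k + 1)" by (rule s)
      \<comment> \<open>Since \<open>k \<ge> N\<close>, the excess \<open>2 * N + 9\<close> is at
        most \<open>12 * k\<close>. The resulting 21, divided by \<open>3 * N\<close>, is the error
        \<open>7 / N\<close>.\<close>
      also have "\<dots> \<le> (2 * real N + 21) * real k"
      proof -
        have "2 * real N + 9 \<le> 2 * real k + 9" using kN by simp
        then show ?thesis using kN by (simp add: algebra_simps)
      qed
      also have "\<dots> = (2 / 3 + 7 / real N) * (3 * real N * real k)" using kN by (simp add: field_simps)
      also have "\<dots> \<le> (2 / 3 + 7 / real N) * t" by (intro mult_left_mono t) auto
      finally show ?thesis using t0 by (simp add: pos_divide_le_eq)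
    qed
    moreover have "s / t \<ge> 2 / 3 - 7 / real N"
    proof -
      have "(2 / 3 - 7 / real N) * t \<le> s"
      \<comment> \<open>The sign decides which bound on \<open>t\<close> is usable. For a negative
        factor it suffices that the lower bound on \<open>s\<close> is non-negative, and this is
        where \<open>N \<ge> 5\<close> enters.\<close>
      proof (cases "2 / 3 - 7 / real N \<ge> 0")
        case True
        then have "(2 / 3 - 7 / real N) * t \<le> (2 / 3 - 7 / real N) * (3 * real N * (real k + 1))"
          by (intro mult_left_mono t)
        also have "\<dots> = (2 * real N - 21) * (real k + 1)" using kN by (simp add: field_simps)
        also have "\<dots> \<le> 2 * real N * real k - 5 * (real k + 1)"
          using kN by (simp add: algebra_simps)
        finally show ?thesis using s(1) by simp
      next
        case False
        then have "(2 / 3 - 7 / real N) * t \<le> 0" using t0 by (simp add: mult_le_0_iff)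
        also have "0 \<le> 2 * real N * real k - 5 * (real k + 1)"
        proof -
          have "5 * (real k + 1) \<le> 10 * real k" using kN by simp
          also have "10 * real k \<le> 2 * real N * real k" using kN by (intro mult_right_mono) auto
          finally show ?thesis by (simp only: diff_ge_0_iff_ge)
        qed
        finally show ?thesis using s(1) by simp
      qed
      then show ?thesis using t0 by (simp add: pos_le_divide_eq)
    qed
    moreover have "ln (S n) / ln (real n) = s / t" by (simp add: s_def t_def)
    ultimately show "norm (ln (S n) / ln (real n) - 2 / 3) < \<epsilon>" using eps by auto
  qed
qed

section \<open>The logarithmic limits\<close>

context rooted_graph begin

text \<open>The dyadic bounds hold almost surely for all of the countably many \<open>N\<close> at
  once. The conclusion also records that the walk stays in \<open>G\<close>, since the degree bounds
  used to pass to cardinalities concern vertices of \<open>G\<close> only.\<close>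

lemma AE_log_vol_ratio:
  assumes x: "x \<in> G"
    and good: "\<And>m. m \<ge> 1 \<Longrightarrow> \<forall>\<^sub>F k in sequentially. (2 ^ k) ^ m \<in> good_scales G E v (2 ^ k)"
  shows "AE X in srw E x. range X \<subseteq> G \<and> (\<lambda>n. ln (vol E (X ` {0..n})) / ln (real n)) \<longlonglongrightarrow> 2 / 3"
proof -
  have "AE X in srw E x. \<forall>N. \<forall>\<^sub>F k in sequentially. N \<ge> 1 \<longrightarrow> X ` {0..2 ^ (3 * N * k)} \<subseteq> G
    \<and> (2 ^ k) ^ (3 * N) / (20 * (2 ^ k) ^ (N + 5)) \<le> vol E (X ` {0..2 ^ (3 * N * k)})
    \<and> vol E (X ` {0..2 ^ (3 * N * k)}) \<le> (2 ^ k) ^ (2 * N + 9)"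
    unfolding AE_all_countable
  proof
    fix N :: nat
    show "AE X in srw E x. \<forall>\<^sub>F k in sequentially. N \<ge> 1 \<longrightarrow> X ` {0..2 ^ (3 * N * k)} \<subseteq> G
      \<and> (2 ^ k) ^ (3 * N) / (20 * (2 ^ k) ^ (N + 5)) \<le> vol E (X ` {0..2 ^ (3 * N * k)})
      \<and> vol E (X ` {0..2 ^ (3 * N * k)}) \<le> (2 ^ k) ^ (2 * N + 9)"
      using AE_dyadic_bounds[OF x _ good, of N] by (cases "N \<ge> 1") simp_all
  qed
  then show ?thesis
  proof eventually_elim
    case (elim X)
    have "mono (\<lambda>n. vol E (X ` {0..n}))"
      unfolding vol_def by (intro monoI sum_mono2) auto
    moreover have "\<forall>\<^sub>F k in sequentially.
        (2 ^ k) ^ (3 * N) / (20 * (2 ^ k) ^ (N + 5)) \<le> vol E (X ` {0..2 ^ (3 * N * k)})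
        \<and> vol E (X ` {0..2 ^ (3 * N * k)}) \<le> (2 ^ k) ^ (2 * N + 9)" if "N \<ge> 1" for N
      using elim[rule_format, of N] that by (auto elim: eventually_mono)
    ultimately have "(\<lambda>n. ln (vol E (X ` {0..n})) / ln (real n)) \<longlonglongrightarrow> 2 / 3"
      by (rule log_ratio_limit)
    \<comment> \<open>The case \<open>N = 1\<close> confines arbitrarily long initial segments to
      \<open>G\<close>.\<close>
    moreover have "X i \<in> G" for i
    proof -
      have "\<forall>\<^sub>F k in sequentially. X ` {0..2 ^ (3 * k)} \<subseteq> G \<and> k \<ge> i"
        using elim[rule_format, of 1] eventually_ge_at_top[of i] by eventually_elim simp
      then obtain k where k: "X ` {0..2 ^ (3 * k)} \<subseteq> G" "k \<ge> i"
        by (auto dest: eventually_happens)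
      have "i \<le> 3 * k" using k(2) by simp
      also have "\<dots> \<le> 2 ^ (3 * k)" using less_exp[of "3 * k"] by simp
      finally show ?thesis using k(1) by auto
    qed
    ultimately show ?case by auto
  qed
qed

text \<open>All degrees lie between 1 and \<open>c\<close>, so volume and cardinality of the range
  differ by a bounded factor, which vanishes after division by \<open>ln n\<close>.\<close>

lemma log_card_ratio:
  assumes X: "range X \<subseteq> G" and lim: "(\<lambda>n. ln (vol E (X ` {0..n})) / ln (real n)) \<longlonglongrightarrow> 2 / 3"
    and deg: "\<And>y. y \<in> G \<Longrightarrow> real (vdeg E y) < c"
  shows "(\<lambda>n. ln (real (card (X ` {0..n}))) / ln (real n)) \<longlonglongrightarrow> 2 / 3"
proof -
  have c: "c > 1" using vdeg_pos[OF root] deg[OF root] by linarith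
  have inv_ln: "(\<lambda>n. ln c / ln (real n)) \<longlonglongrightarrow> 0"
    by real_asymp
  have "(\<lambda>n. ln (vol E (X ` {0..n})) / ln (real n) - ln c / ln (real n)) \<longlonglongrightarrow> 2 / 3 - 0"
    by (intro tendsto_diff lim inv_ln)
  then have lim': "(\<lambda>n. (ln (vol E (X ` {0..n})) - ln c) / ln (real n)) \<longlonglongrightarrow> 2 / 3"
    by (simp add: diff_divide_distrib)
  have card: "0 < card (X ` {0..n})" for n by (simp add: card_gt_0_iff)
  have le: "real (card (X ` {0..n})) \<le> vol E (X ` {0..n})" for n
  proof -
    have "(\<Sum>y\<in>X ` {0..n}. 1) \<le> vol E (X ` {0..n})"
      unfolding vol_def using X vdeg_pos by (intro sum_mono) force
    then show ?thesis by simp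
  qed
  have ge: "vol E (X ` {0..n}) \<le> real (card (X ` {0..n})) * c" for n
  proof -
    have "vol E (X ` {0..n}) \<le> (\<Sum>y\<in>X ` {0..n}. c)"
      unfolding vol_def using X deg by (intro sum_mono less_imp_le) auto
    then show ?thesis by simp
  qed
  show ?thesis
  proof (rule tendsto_sandwich[OF _ _ lim' lim])
    show "\<forall>\<^sub>F n in sequentially. (ln (vol E (X ` {0..n})) - ln c) / ln (real n) \<le> ln (real (card (X ` {0..n}))) / ln (real n)"
      using eventually_ge_at_top[of 2]
    proof eventually_elim
      case (elim n)
      have "ln (vol E (X ` {0..n})) \<le> ln (real (card (X ` {0..n})) * c)"
        using ge[of n] le[of n] card[of n] by (intro ln_mono) auto
      then have "ln (vol E (X ` {0..n})) - ln c \<le> ln (real (card (X ` {0..n})))"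
        using card[of n] c by (simp add: ln_mult)
      then show ?case using elim by (intro divide_right_mono) auto
    qed
    show "\<forall>\<^sub>F n in sequentially. ln (real (card (X ` {0..n}))) / ln (real n) \<le> ln (vol E (X ` {0..n})) / ln (real n)"
      using eventually_ge_at_top[of 2]
    proof eventually_elim
      case (elim n)
      have "ln (real (card (X ` {0..n}))) \<le> ln (vol E (X ` {0..n}))"
        using le[of n] card[of n] by (intro ln_mono) auto
      then show ?case using elim by (intro divide_right_mono) auto
    qed
  qed
qed

end

text \<open>Letting the constant of goodness grow like \<open>2 ^ k\<close> makes any polynomial
  tail of \<open>p\<close> geometric in \<open>k\<close>, hence summable for every
  \<open>q0 > 0\<close>.\<close>

lemma AE_eventually_good_scales:
  fixes M :: "'w measure" and good :: "'w \<Rightarrow> real \<Rightarrow> real set"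
  assumes "prob_space M" and params: "c1 > 0" "q0 > 0" and m: "m \<ge> 1"
    and p_le: "\<And>l. l > 1 \<Longrightarrow> p l \<le> c1 * l powr (- q0)"
    and ev: "\<And>R l. R \<ge> Rs \<Longrightarrow> l > 1 \<Longrightarrow> {\<omega> \<in> space M. R \<in> good \<omega> l} \<in> sets M"
    and pr: "\<And>R l. R \<ge> Rs \<Longrightarrow> l > 1 \<Longrightarrow> measure M {\<omega> \<in> space M. R \<in> good \<omega> l} \<ge> 1 - p l"
  shows "AE \<omega> in M. \<forall>\<^sub>F k in sequentially. (2 ^ k) ^ m \<in> good \<omega> (2 ^ k)"
proof -
  interpret prob_space M by fact
  have "filterlim (\<lambda>k. 2 ^ k :: real) at_top sequentially" by real_asymp
  then have "\<forall>\<^sub>F k in sequentially. Rs \<le> 2 ^ k" by (simp add: filterlim_at_top)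
  then have "\<forall>\<^sub>F k in sequentially. Rs \<le> 2 ^ k \<and> k \<ge> 1" by (intro eventually_conj eventually_ge_at_top)
  then obtain K where K: "\<And>k. k \<ge> K \<Longrightarrow> Rs \<le> 2 ^ k \<and> k \<ge> 1" unfolding eventually_sequentially by blast
  \<comment> \<open>Before \<open>K\<close> the scale may lie below \<open>Rs\<close>, where nothing
    is assumed.\<close>
  define B where "B k = (if k \<ge> K then space M - {\<omega> \<in> space M. (2 ^ k) ^ m \<in> good \<omega> (2 ^ k)} else {})" for k :: nat
  have Rl: "(2 ^ k) ^ m \<ge> Rs" "(2 ^ k :: real) > 1" if "k \<ge> K" for k
  proof -
    have "Rs \<le> 2 ^ k" using K that by blast
    also have "\<dots> \<le> (2 ^ k) ^ m" using m self_le_power[of "2 ^ k :: real" m] by simp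
    finally show "(2 ^ k) ^ m \<ge> Rs" .
    show "(2 ^ k :: real) > 1" using K[OF that] by (simp add: one_less_power)
  qed
  have B: "B k \<in> events" for k using ev Rl unfolding B_def by auto
  have PB: "prob (B k) \<le> c1 * (2 powr (- q0)) ^ k" for k
  proof (cases "k \<ge> K")
    case True
    have "prob (B k) = 1 - prob {\<omega> \<in> space M. (2 ^ k) ^ m \<in> good \<omega> (2 ^ k)}"
      using True ev[OF Rl[OF True]] by (simp add: B_def prob_compl)
    also have "\<dots> \<le> c1 * (2 ^ k) powr (- q0)" using pr[OF Rl[OF True]] p_le[OF Rl(2)[OF True]] by linarith
    also have "(2 ^ k) powr (- q0) = (2 powr (- q0)) ^ k"
      by (simp add: powr_powr mult.commute flip: powr_realpow)
    finally show ?thesis .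
  qed (use params in \<open>simp add: B_def\<close>)
  have "summable (\<lambda>k. c1 * (2 powr (- q0)) ^ k)"
    using params by (intro summable_mult summable_geometric) (simp add: powr_less_one)
  then have "summable (\<lambda>k. prob (B k))"
    by (rule summable_comparison_test') (use PB in simp)
  then have "AE \<omega> in M. \<forall>\<^sub>F k in sequentially. \<omega> \<in> space M - B k"
    using B by (intro borel_cantelli_AE1) (auto simp: emeasure_finite less_top[symmetric])
  then show ?thesis
  proof eventually_elim
    case (elim \<omega>)
    with eventually_ge_at_top[of K] show ?case
      by eventually_elim (auto simp: B_def)
  qed
qed

text \<open>\<open>J_event\<close> spells out the measurability implicit in the probabilities. A
  single \<open>\<Omega>0\<close>, chosen before the degree bound is assumed, serves both
  parts.\<close>

theorem theorem1p6:
  fixes M :: "'w measure"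
    and G :: "'w \<Rightarrow> 'v set" and E :: "'w \<Rightarrow> 'v set set" and zero :: "'w \<Rightarrow> 'v"
    and Rs c1 q0 :: real and p :: "real \<Rightarrow> real"
  assumes prob: "prob_space M"
    and graph: "\<And>\<omega>. \<omega> \<in> space M \<Longrightarrow> simple_graph (G \<omega>) (E \<omega>)"
    and inf: "\<And>\<omega>. \<omega> \<in> space M \<Longrightarrow> infinite (G \<omega>)"
    and loc_fin: "\<And>\<omega>. \<omega> \<in> space M \<Longrightarrow> locally_finite_graph (G \<omega>) (E \<omega>)"
    and conn: "\<And>\<omega>. \<omega> \<in> space M \<Longrightarrow> connected_graph (G \<omega>) (E \<omega>)"
    and zero: "\<And>\<omega>. \<omega> \<in> space M \<Longrightarrow> zero \<omega> \<in> G \<omega>"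
    and params: "Rs \<ge> 1" "c1 > 0" "q0 > 0"
    and p_nonneg: "\<And>l. l > 1 \<Longrightarrow> p l \<ge> 0"
    and p_le: "\<And>l. l > 1 \<Longrightarrow> p l \<le> c1 * l powr (- q0)"
    and J_event: "\<And>R l. R \<ge> Rs \<Longrightarrow> l > 1 \<Longrightarrow>
      {\<omega> \<in> space M. R \<in> good_scales (G \<omega>) (E \<omega>) (zero \<omega>) l} \<in> sets M"
    and J_prob: "\<And>R l. R \<ge> Rs \<Longrightarrow> l > 1 \<Longrightarrow>
      measure M {\<omega> \<in> space M. R \<in> good_scales (G \<omega>) (E \<omega>) (zero \<omega>) l} \<ge> 1 - p l"
  shows "\<exists>\<Omega>0 \<in> sets M. measure M \<Omega>0 = 1
    \<and> (\<forall>\<omega>\<in>\<Omega>0. \<forall>x\<in>G \<omega>. AE X in srw (E \<omega>) x.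
          (\<lambda>n. ln (vol (E \<omega>) (X ` {0..n})) / ln (real n)) \<longlonglongrightarrow> 2/3)
    \<and> ((\<exists>c0::real. \<forall>\<omega>\<in>space M. \<forall>x\<in>G \<omega>. real (vdeg (E \<omega>) x) < c0) \<longrightarrow>
        (\<forall>\<omega>\<in>\<Omega>0. \<forall>x\<in>G \<omega>. AE X in srw (E \<omega>) x.
          (\<lambda>n. ln (real (card (X ` {0..n}))) / ln (real n)) \<longlonglongrightarrow> 2/3))"
proof -
  interpret prob_space M by (rule prob)
  let ?good = "\<lambda>\<omega>. good_scales (G \<omega>) (E \<omega>) (zero \<omega>)"
  have "AE \<omega> in M. \<forall>m. m \<ge> 1 \<longrightarrow> (\<forall>\<^sub>F k in sequentially. (2 ^ k) ^ m \<in> ?good \<omega> (2 ^ k))"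
    unfolding AE_all_countable
  proof
    fix m :: nat
    show "AE \<omega> in M. m \<ge> 1 \<longrightarrow> (\<forall>\<^sub>F k in sequentially. (2 ^ k) ^ m \<in> ?good \<omega> (2 ^ k))"
    proof (cases "m \<ge> 1")
      case True
      have "AE \<omega> in M. \<forall>\<^sub>F k in sequentially. (2 ^ k) ^ m \<in> ?good \<omega> (2 ^ k)"
        by (rule AE_eventually_good_scales[OF prob params(2,3) True p_le J_event J_prob])
      then show ?thesis by eventually_elim simp
    qed simp
  qed
  \<comment> \<open>The null set is measurable even if the exceptional set inside it is not, so its
    complement can serve as \<open>\<Omega>0\<close>.\<close>
  then obtain N where N: "N \<in> null_sets M"
    "{\<omega> \<in> space M. \<not> (\<forall>m. m \<ge> 1 \<longrightarrow> (\<forall>\<^sub>F k in sequentially. (2 ^ k) ^ m \<in> ?good \<omega> (2 ^ k)))} \<subseteq> N"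
    by (auto simp: eventually_ae_filter)
  have walk: "AE X in srw (E \<omega>) x. range X \<subseteq> G \<omega> \<and> (\<lambda>n. ln (vol (E \<omega>) (X ` {0..n})) / ln (real n)) \<longlonglongrightarrow> 2/3"
    and rooted: "rooted_graph (G \<omega>) (E \<omega>) (zero \<omega>)"
    if "\<omega> \<in> space M - N" "x \<in> G \<omega>" for \<omega> x
  proof -
    show rooted: "rooted_graph (G \<omega>) (E \<omega>) (zero \<omega>)"
      using that by (intro rooted_graph.intro graph inf loc_fin conn zero) auto
    have "\<forall>m. m \<ge> 1 \<longrightarrow> (\<forall>\<^sub>F k in sequentially. (2 ^ k) ^ m \<in> ?good \<omega> (2 ^ k))"
      using that(1) N(2) by blast
    then show "AE X in srw (E \<omega>) x. range X \<subseteq> G \<omega> \<and> (\<lambda>n. ln (vol (E \<omega>) (X ` {0..n})) / ln (real n)) \<longlonglongrightarrow> 2/3"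
      by (intro rooted_graph.AE_log_vol_ratio[OF rooted that(2)]) blast
  qed
  show ?thesis
  proof (intro bexI[of _ "space M - N"] conjI impI ballI)
    show "space M - N \<in> events" using N(1) by (auto dest: null_setsD2)
    have "prob N = 0" using N(1) by (simp add: measure_eq_0_null_sets)
    then show "prob (space M - N) = 1" using N(1) by (simp add: prob_compl null_setsD2)
  next
    fix \<omega> x assume "\<omega> \<in> space M - N" "x \<in> G \<omega>"
    from walk[OF this] show "AE X in srw (E \<omega>) x. (\<lambda>n. ln (vol (E \<omega>) (X ` {0..n})) / ln (real n)) \<longlonglongrightarrow> 2/3"
      by eventually_elim simp
  next
    fix \<omega> x
    assume "\<exists>c0::real. \<forall>\<omega>\<in>space M. \<forall>x\<in>G \<omega>. real (vdeg (E \<omega>) x) < c0"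
      and \<omega>: "\<omega> \<in> space M - N" "x \<in> G \<omega>"
    then obtain c0 where c0: "\<And>y. y \<in> G \<omega> \<Longrightarrow> real (vdeg (E \<omega>) y) < c0" by blast
    from walk[OF \<omega>] show "AE X in srw (E \<omega>) x. (\<lambda>n. ln (real (card (X ` {0..n}))) / ln (real n)) \<longlonglongrightarrow> 2/3"
      by eventually_elim (use rooted_graph.log_card_ratio[OF rooted[OF \<omega>] _ _ c0] in blast)
  qed
qed

end
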